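(* Assume the Framework and the Purification Postulate. Let $\rho\in\mathfrak S_1(\mathrm A)$ and let $\mathcal C\in\mathfrak T(\mathrm A,\mathrm B)$ be a channel. Then $\mathcal C$ is correctable upon input of $\rho$ if and only if there exist a reversible dilation $\mathcal V\in\mathfrak T(\mathrm A,\mathrm B\mathrm E)$ of $\mathcal C$, a purification $\Psi_\rho\in\mathfrak S_1(\mathrm A\mathrm R)$ of $\rho$, and a state $\sigma\in\mathfrak S_1(\mathrm E)$ such that $(e_{\mathrm B}\otimes\mathcal I_{\mathrm E}\otimes\mathcal I_{\mathrm R})(\mathcal V\otimes\mathcal I_{\mathrm R})\Psi_\rho=\sigma\otimes\tilde\rho$, where $\tilde\rho:=(e_{\mathrm A}\otimes\mathcal I_{\mathrm R})\Psi_\rho$.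
   Context: Framework. We work in an operational-probabilistic theory: there is a collection of systems $\mathrm A,\mathrm B,\dots$, closed under a composition $\mathrm A\mathrm B$ (associative, symmetric up to a reversible swap, with a trivial system $\mathrm I$ satisfying $\mathrm A\mathrm I=\mathrm A$); for each pair of systems a set $\mathfrak T(\mathrm A,\mathrm B)$ of transformations; a test from $\mathrm A$ to $\mathrm B$ is a finite collection $\{\mathcal C_i\}_{i\in X}\subseteq\mathfrak T(\mathrm A,\mathrm B)$, and every transformation belongs to some test. Tests are closed under sequential composition, parallel composition ($\otimes$), coarse-graining (summing outcomes over the blocks of a partition of $X$) and conditioning (choosing the next test depending on the outcome of the previous one). States of $\mathrm A$ are the elements of $\mathfrak S(\mathrm A):=\mathfrak T(\mathrm I,\mathrm A)$, effects are the elements of $\mathfrak T(\mathrm A,\mathrm I)$, and transformations $\mathrm I\to\mathrm I$ are probabilities in $[0,1]$ (those of a test sum to $1$; composition is multiplication). An effect $a$ and a state $\rho$ give the probability $(a|\rho)$. States (effects) are identified when they give equal probabilities on all effects (states); transformations $\mathcal C,\mathcal C'$ are identified when $\mathcal C\otimes\mathcal I_{\mathrm S}$ and $\mathcal C'\otimes\mathcal I_{\mathrm S}$ act identically on all states of $\mathrm A\mathrm S$ for every system $\mathrm S$. States span a finite-dimensional real vector space $\mathfrak S_{\mathbb R}(\mathrm A)$, transformations act linearly, and $\mathfrak T_{\mathbb R}(\mathrm A,\mathrm B)$ is the real span of $\mathfrak T(\mathrm A,\mathrm B)$. Standing assumptions: (i) causality: each system $\mathrm A$ has a unique deterministic effect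 $e_{\mathrm A}$ (the effect forming a one-outcome observation test), and $e_{\mathrm A\mathrm B}=e_{\mathrm A}\otimes e_{\mathrm B}$; (ii) local discriminability: if two states of $\mathrm A\mathrm B$ differ, some product effect $a\otimes b$ gives them different probabilities; (iii) all sets of states are closed, the theory is not deterministic (hence all sets of states, effects and transformations are convex), and perfectly distinguishable states exist. A state $\rho$ is normalized if $(e|\rho)=1$; $\mathfrak S_1(\mathrm A)$ is the set of normalized states. A channel is a $\mathcal C\in\mathfrak T(\mathrm A,\mathrm B)$ with $e_{\mathrm B}\circ\mathcal C=e_{\mathrm A}$. A channel $\mathcal U\in\mathfrak T(\mathrm A,\mathrm B)$ is reversible if some channel $\mathcal W\in\mathfrak T(\mathrm B,\mathrm A)$ satisfies $\mathcal W\mathcal U=\mathcal I_{\mathrm A}$, $\mathcal U\mathcal W=\mathcal I_{\mathrm B}$; $\mathbf G_{\mathrm A}$ is the group of reversible channels on $\mathrm A$. The marginal of a state $\sigma$ of $\mathrm A\mathrm B$ on $\mathrm A$ is $(\mathcal I_{\mathrm A}\otimes e_{\mathrm B})\sigma$. Refinement. For $\mathcal C\in\mathfrak T(\mathrm A,\mathrm B)$, write $\mathcal D\prec\mathcal C$ if there are a test $\{\mathcal D_j\}_{j\in Y}$ and $Y_0\subseteq Y$ with $\mathcal C=\sum_{j\in Y_0}\mathcal D_j$ and $\mathcal D\in\{\mathcal D_j\}_{j\in Y_0}$; the refinement set is $D_{\mathcal C}=\{\mathcal D:\mathcal D\prec\mathcal C\}$. $\mathcal C$ is atomic if $\mathcal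 D\prec\mathcal C$ implies $\mathcal D=\lambda\mathcal C$ for some $\lambda\in[0,1]$. A pure state is an atomic state; a state is mixed otherwise. Purification Postulate. For every $\rho\in\mathfrak S_1(\mathrm A)$ there are a system $\mathrm B$ and a pure $\Psi\in\mathfrak S_1(\mathrm A\mathrm B)$ with $(\mathcal I_{\mathrm A}\otimes e_{\mathrm B})\Psi=\rho$ (a purification of $\rho$, with purifying system $\mathrm B$); and if $\Psi,\Psi'\in\mathfrak S_1(\mathrm A\mathrm B)$ are purifications of the same state, then $\Psi'=(\mathcal I_{\mathrm A}\otimes\mathcal U)\Psi$ for some $\mathcal U\in\mathbf G_{\mathrm B}$. A reversible dilation of $\mathcal C\in\mathfrak T(\mathrm A,\mathrm B)$ is a channel $\mathcal V\in\mathfrak T(\mathrm A,\mathrm B\mathrm E)$ with $(\mathcal I_{\mathrm B}\otimes e_{\mathrm E})\mathcal V=\mathcal C$ that is of the form $\mathcal V=\mathcal U(\mathcal I_{\mathrm A}\otimes\varphi_0)$ for a pure state $\varphi_0$ of some system $\mathrm E_0$ and a reversible channel $\mathcal U\in\mathfrak T(\mathrm A\mathrm E_0,\mathrm B\mathrm E)$. A channel $\mathcal C\in\mathfrak T(\mathrm A,\mathrm B)$ is correctable upon input of $\rho$ if there is a channel $\mathcal R\in\mathfrak T(\mathrm B,\mathrm A)$ with $\mathcal R\mathcal C\sigma=\sigma$ for all $\sigma\in D_\rho$. *)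

theory Defs
  imports "HOL-Analysis.Analysis"
begin

text \<open>
  An operational-probabilistic theory (OPT) is modelled by a record of operations.
  The type 's is the type of systems, 't is a real normed vector space in which all
  transformations live (each hom-set o_Tr T A B is a subset of it; sums of
  transformations, i.e. coarse-grainings and elements of the real span, are vector sums).
  Equality in 't is the operational identification of transformations.
  Tests are finite (nonempty) lists of transformations, indexed by list positions.
\<close>

record ('s, 't) opt =
  o_sc    :: "'s \<Rightarrow> 's \<Rightarrow> 's"         (* composite system AB *)
  o_I     :: "'s"                          (* trivial system *)
  o_Tr    :: "'s \<Rightarrow> 's \<Rightarrow> 't set"
  o_seq   :: "'t \<Rightarrow> 't \<Rightarrow> 't"         (* o_seq D C = D \<circ> C *)
  o_ten   :: "'t \<Rightarrow> 't \<Rightarrow> 't"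
  o_id    :: "'s \<Rightarrow> 't"
  o_swap  :: "'s \<Rightarrow> 's \<Rightarrow> 't"
  o_Tests :: "'s \<Rightarrow> 's \<Rightarrow> 't list set"

context
  fixes T :: "('s, 't::real_normed_vector) opt"
begin

definition states :: "'s \<Rightarrow> 't set" where
  "states A = o_Tr T (o_I T) A"

definition effects :: "'s \<Rightarrow> 't set" where
  "effects A = o_Tr T A (o_I T)"

text \<open>Transformations I \<rightarrow> I are probabilities: p = c *R (identity of I).\<close>
definition prob :: "'t \<Rightarrow> 't \<Rightarrow> real" where
  "prob a \<rho> = (THE c. o_seq T a \<rho> = c *\<^sub>R o_id T (o_I T))"

definition det_eff :: "'s \<Rightarrow> 't" where
  "det_eff A = (THE a. [a] \<in> o_Tests T A (o_I T))"

definition norm_states :: "'s \<Rightarrow> 't set" where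
  "norm_states A = {\<rho> \<in> states A. prob (det_eff A) \<rho> = 1}"

definition channel :: "'s \<Rightarrow> 's \<Rightarrow> 't \<Rightarrow> bool" where
  "channel A B C \<longleftrightarrow> C \<in> o_Tr T A B \<and> o_seq T (det_eff B) C = det_eff A"

definition reversible :: "'s \<Rightarrow> 's \<Rightarrow> 't \<Rightarrow> bool" where
  "reversible A B U \<longleftrightarrow> channel A B U \<and>
     (\<exists>W. channel B A W \<and> o_seq T W U = o_id T A \<and> o_seq T U W = o_id T B)"

definition refines :: "'s \<Rightarrow> 's \<Rightarrow> 't \<Rightarrow> 't \<Rightarrow> bool" where
  "refines A B D C \<longleftrightarrow> (\<exists>ds Y0. ds \<in> o_Tests T A B \<and> Y0 \<subseteq> {..<length ds} \<and>
      C = (\<Sum>j\<in>Y0. ds ! j) \<and> D \<in> (\<lambda>j. ds ! j) ` Y0)"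

definition refinement_set :: "'s \<Rightarrow> 's \<Rightarrow> 't \<Rightarrow> 't set" where
  "refinement_set A B C = {D. refines A B D C}"

definition atomic :: "'s \<Rightarrow> 's \<Rightarrow> 't \<Rightarrow> bool" where
  "atomic A B C \<longleftrightarrow> (\<forall>D. refines A B D C \<longrightarrow> (\<exists>l\<in>{0..1}. D = l *\<^sub>R C))"

definition pure_state :: "'s \<Rightarrow> 't \<Rightarrow> bool" where
  "pure_state A \<rho> \<longleftrightarrow> \<rho> \<in> states A \<and> atomic (o_I T) A \<rho>"

definition marginal :: "'s \<Rightarrow> 's \<Rightarrow> 't \<Rightarrow> 't" where
  "marginal A B \<sigma> = o_seq T (o_ten T (o_id T A) (det_eff B)) \<sigma>"

definition purification :: "'s \<Rightarrow> 's \<Rightarrow> 't \<Rightarrow> 't \<Rightarrow> bool" where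
  "purification A R \<rho> \<Psi> \<longleftrightarrow> \<Psi> \<in> norm_states (o_sc T A R) \<and>
     pure_state (o_sc T A R) \<Psi> \<and> marginal A R \<Psi> = \<rho>"

definition purification_postulate :: bool where
  "purification_postulate \<longleftrightarrow>
     (\<forall>A \<rho>. \<rho> \<in> norm_states A \<longrightarrow> (\<exists>B \<Psi>. purification A B \<rho> \<Psi>)) \<and>
     (\<forall>A B \<rho> \<Psi> \<Psi>'. purification A B \<rho> \<Psi> \<and> purification A B \<rho> \<Psi>' \<longrightarrow>
        (\<exists>U. reversible B B U \<and> \<Psi>' = o_seq T (o_ten T (o_id T A) U) \<Psi>))"

definition rev_dilation :: "'s \<Rightarrow> 's \<Rightarrow> 's \<Rightarrow> 't \<Rightarrow> 't \<Rightarrow> bool" where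
  "rev_dilation A B E C V \<longleftrightarrow> channel A (o_sc T B E) V \<and>
     o_seq T (o_ten T (o_id T B) (det_eff E)) V = C \<and>
     (\<exists>E0 \<phi>0 U. pure_state E0 \<phi>0 \<and> reversible (o_sc T A E0) (o_sc T B E) U \<and>
        V = o_seq T U (o_ten T (o_id T A) \<phi>0))"

definition correctable :: "'s \<Rightarrow> 's \<Rightarrow> 't \<Rightarrow> 't \<Rightarrow> bool" where
  "correctable A B C \<rho> \<longleftrightarrow> (\<exists>R. channel B A R \<and>
     (\<forall>\<sigma>\<in>refinement_set (o_I T) A \<rho>. o_seq T R (o_seq T C \<sigma>) = \<sigma>))"

definition OPT_framework :: bool where
  "OPT_framework \<longleftrightarrow>
   \<comment> \<open>systems: associative composition with unit\<close>
   (\<forall>A. o_sc T A (o_I T) = A \<and> o_sc T (o_I T) A = A) \<and>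
   (\<forall>A B C. o_sc T (o_sc T A B) C = o_sc T A (o_sc T B C)) \<and>
   \<comment> \<open>typing of the operations\<close>
   (\<forall>A. o_id T A \<in> o_Tr T A A) \<and>
   (\<forall>A B C f g. f \<in> o_Tr T A B \<longrightarrow> g \<in> o_Tr T B C \<longrightarrow> o_seq T g f \<in> o_Tr T A C) \<and>
   (\<forall>A B C D f g. f \<in> o_Tr T A B \<longrightarrow> g \<in> o_Tr T C D \<longrightarrow>
        o_ten T f g \<in> o_Tr T (o_sc T A C) (o_sc T B D)) \<and>
   (\<forall>A B. o_swap T A B \<in> o_Tr T (o_sc T A B) (o_sc T B A)) \<and>
   \<comment> \<open>category laws\<close>
   (\<forall>A B f. f \<in> o_Tr T A B \<longrightarrow> o_seq T (o_id T B) f = f \<and> o_seq T f (o_id T A) = f) \<and>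
   (\<forall>A B C D f g h. f \<in> o_Tr T A B \<longrightarrow> g \<in> o_Tr T B C \<longrightarrow> h \<in> o_Tr T C D \<longrightarrow>
        o_seq T h (o_seq T g f) = o_seq T (o_seq T h g) f) \<and>
   \<comment> \<open>monoidal laws\<close>
   (\<forall>A B. o_ten T (o_id T A) (o_id T B) = o_id T (o_sc T A B)) \<and>
   (\<forall>A B C D E F f f' g g'. f \<in> o_Tr T A B \<longrightarrow> f' \<in> o_Tr T B C \<longrightarrow>
        g \<in> o_Tr T D E \<longrightarrow> g' \<in> o_Tr T E F \<longrightarrow>
        o_ten T (o_seq T f' f) (o_seq T g' g) = o_seq T (o_ten T f' g') (o_ten T f g)) \<and>
   (\<forall>A B C D E F f g h. f \<in> o_Tr T A B \<longrightarrow> g \<in> o_Tr T C D \<longrightarrow> h \<in> o_Tr T E F \<longrightarrow>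
        o_ten T (o_ten T f g) h = o_ten T f (o_ten T g h)) \<and>
   (\<forall>A B f. f \<in> o_Tr T A B \<longrightarrow>
        o_ten T f (o_id T (o_I T)) = f \<and> o_ten T (o_id T (o_I T)) f = f) \<and>
   \<comment> \<open>symmetry: the swap is a reversible channel, natural, and self-inverse\<close>
   (\<forall>A B. o_seq T (o_swap T B A) (o_swap T A B) = o_id T (o_sc T A B)) \<and>
   (\<forall>A B C D f g. f \<in> o_Tr T A B \<longrightarrow> g \<in> o_Tr T C D \<longrightarrow>
        o_seq T (o_swap T B D) (o_ten T f g) = o_seq T (o_ten T g f) (o_swap T A C)) \<and>
   \<comment> \<open>linearity (transformations act linearly on the real spans)\<close>
   bilinear (o_seq T) \<and> bilinear (o_ten T) \<and>
   \<comment> \<open>probabilities: transformations I \<rightarrow> I are reals in [0,1]\<close>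
   o_id T (o_I T) \<noteq> 0 \<and>
   o_Tr T (o_I T) (o_I T) \<subseteq> {c *\<^sub>R o_id T (o_I T) | c. 0 \<le> c \<and> c \<le> 1} \<and>
   \<comment> \<open>tests\<close>
   (\<forall>A B ts. ts \<in> o_Tests T A B \<longrightarrow> ts \<noteq> [] \<and> set ts \<subseteq> o_Tr T A B) \<and>
   (\<forall>A B C. C \<in> o_Tr T A B \<longrightarrow> (\<exists>ts\<in>o_Tests T A B. C \<in> set ts)) \<and>
   (\<forall>ps. ps \<in> o_Tests T (o_I T) (o_I T) \<longrightarrow> sum_list ps = o_id T (o_I T)) \<and>
   (\<forall>A. [o_id T A] \<in> o_Tests T A A) \<and>
   (\<forall>A B. [o_swap T A B] \<in> o_Tests T (o_sc T A B) (o_sc T B A)) \<and>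
   (\<forall>A B C ts us. ts \<in> o_Tests T A B \<longrightarrow> us \<in> o_Tests T B C \<longrightarrow>
        [o_seq T u t. t \<leftarrow> ts, u \<leftarrow> us] \<in> o_Tests T A C) \<and>
   (\<forall>A B C D ts us. ts \<in> o_Tests T A B \<longrightarrow> us \<in> o_Tests T C D \<longrightarrow>
        [o_ten T t u. t \<leftarrow> ts, u \<leftarrow> us] \<in> o_Tests T (o_sc T A C) (o_sc T B D)) \<and>
   (\<forall>A B ts (f::nat \<Rightarrow> nat) m. ts \<in> o_Tests T A B \<longrightarrow>
        (\<forall>i<length ts. f i < m) \<longrightarrow> (\<forall>k<m. \<exists>i<length ts. f i = k) \<longrightarrow>
        map (\<lambda>k. \<Sum>i\<in>{i. i < length ts \<and> f i = k}. ts ! i) [0..<m] \<in> o_Tests T A B) \<and>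
   (\<forall>A B C ts (us::nat \<Rightarrow> 't list). ts \<in> o_Tests T A B \<longrightarrow>
        (\<forall>i<length ts. us i \<in> o_Tests T B C) \<longrightarrow>
        concat (map (\<lambda>i. map (\<lambda>u. o_seq T u (ts ! i)) (us i)) [0..<length ts])
          \<in> o_Tests T A C) \<and>
   \<comment> \<open>operational identification of states, effects and transformations\<close>
   (\<forall>A \<rho> \<sigma>. \<rho> \<in> states A \<longrightarrow> \<sigma> \<in> states A \<longrightarrow>
        (\<forall>a\<in>effects A. prob a \<rho> = prob a \<sigma>) \<longrightarrow> \<rho> = \<sigma>) \<and>
   (\<forall>A a b. a \<in> effects A \<longrightarrow> b \<in> effects A \<longrightarrow>
        (\<forall>\<rho>\<in>states A. prob a \<rho> = prob b \<rho>) \<longrightarrow> a = b) \<and>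
   (\<forall>A B C C'. C \<in> o_Tr T A B \<longrightarrow> C' \<in> o_Tr T A B \<longrightarrow>
        (\<forall>S. \<forall>\<rho>\<in>states (o_sc T A S).
            o_seq T (o_ten T C (o_id T S)) \<rho> = o_seq T (o_ten T C' (o_id T S)) \<rho>) \<longrightarrow>
        C = C') \<and>
   \<comment> \<open>states span a finite-dimensional real vector space\<close>
   (\<forall>A. \<exists>F. finite F \<and> states A \<subseteq> span F) \<and>
   \<comment> \<open>(i) causality\<close>
   (\<forall>A. \<exists>!a. [a] \<in> o_Tests T A (o_I T)) \<and>
   (\<forall>A B. det_eff (o_sc T A B) = o_ten T (det_eff A) (det_eff B)) \<and>
   \<comment> \<open>(ii) local discriminability\<close>
   (\<forall>A B \<rho> \<sigma>. \<rho> \<in> states (o_sc T A B) \<longrightarrow> \<sigma> \<in> states (o_sc T A B) \<longrightarrow> \<rho> \<noteq> \<sigma> \<longrightarrow>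
        (\<exists>a\<in>effects A. \<exists>b\<in>effects B. prob (o_ten T a b) \<rho> \<noteq> prob (o_ten T a b) \<sigma>)) \<and>
   \<comment> \<open>(iii) closed sets of states, non-determinism, convexity,
        existence of perfectly distinguishable states\<close>
   (\<forall>A. closed (states A)) \<and>
   (\<exists>A a \<rho>. a \<in> effects A \<and> \<rho> \<in> states A \<and> prob a \<rho> \<noteq> 0 \<and> prob a \<rho> \<noteq> 1) \<and>
   (\<forall>A B. convex (o_Tr T A B)) \<and>
   (\<exists>A \<rho>1 \<rho>2 a1 a2. \<rho>1 \<in> norm_states A \<and> \<rho>2 \<in> norm_states A \<and>
        [a1, a2] \<in> o_Tests T A (o_I T) \<and> prob a1 \<rho>1 = 1 \<and> prob a2 \<rho>2 = 1)"

end

end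

theory Submission
  imports Defs
begin

text \<open>
  Let \<open>V\<close> be a reversible dilation of \<open>C\<close> with environment \<open>E\<close>, and \<open>\<Psi>\<close> a purification of \<open>\<rho>\<close> on \<open>AR\<close>.
  By local discriminability and steering (every refinement of \<open>\<rho>\<close> arises from an effect on \<open>R\<close>), a
  channel \<open>N\<close> corrects \<open>C\<close> upon input of \<open>\<rho>\<close> iff \<open>NC \<otimes> I\<close> fixes \<open>\<Psi>\<close>. If so, \<open>N\<close> applied to \<open>V\<Psi>\<close> is a
  state of \<open>AER\<close> whose marginal on \<open>AR\<close> is the pure state \<open>\<Psi>\<close>; hence it is a product, and discarding
  \<open>A\<close> decouples \<open>E\<close> from \<open>R\<close>. Conversely, if the marginal of \<open>V\<Psi>\<close> on \<open>ER\<close> is a product, it is also purified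
  by \<open>\<Psi>\<close> times a purification of \<open>\<sigma>\<close>, and uniqueness of purification yields a channel out of
  \<open>B\<close> that restores \<open>\<Psi>\<close>. A dilation exists because \<open>C\<close> is determined by its action on the purification of
  an internal state: purify the image and again use uniqueness.
\<close>

text \<open>The hom-sets overlap (0 lies in all nonempty ones), so a transformation does not determine its
  systems; carrying them along lets the simplifier discharge the typing premises of the
  monoidal laws.\<close>

datatype ('s, 't) arrow = Arrow (src: 's) (mor: 't) (tgt: 's)

section \<open>The axioms of the framework as individual facts\<close>

locale opt_theory =
  fixes T :: "('s, 't::real_normed_vector) opt"
  assumes framework: "OPT_framework T"
begin

abbreviation sys_comp :: "'s \<Rightarrow> 's \<Rightarrow> 's" (infixr "\<odot>" 80) where
  "A \<odot> B \<equiv> o_sc T A B"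

abbreviation unit_sys :: 's ("\<I>") where
  "\<I> \<equiv> o_I T"

abbreviation Tr :: "'s \<Rightarrow> 's \<Rightarrow> 't set" where
  "Tr \<equiv> o_Tr T"

abbreviation Tests :: "'s \<Rightarrow> 's \<Rightarrow> 't list set" where
  "Tests \<equiv> o_Tests T"

text \<open>The conjuncts of \<open>OPT_framework\<close> are split off one at a time. Each
  statement keeps its object-level quantifiers so that it matches a conjunct literally;
  \<open>rule_format\<close> then turns it into a usable rule.\<close>

lemma
  shows sys_unit [rule_format]: "\<forall>A. A \<odot> \<I> = A \<and> \<I> \<odot> A = A"
    and sys_assoc [rule_format, simp]: "\<forall>A B D. (A \<odot> B) \<odot> D = A \<odot> B \<odot> D"
    and id_Tr [rule_format]: "\<forall>A. o_id T A \<in> Tr A A"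
    and seq_Tr [rule_format]:
      "\<forall>A B D f g. f \<in> Tr A B \<longrightarrow> g \<in> Tr B D \<longrightarrow> o_seq T g f \<in> Tr A D"
    and ten_Tr [rule_format]:
      "\<forall>A B D E f g. f \<in> Tr A B \<longrightarrow> g \<in> Tr D E \<longrightarrow> o_ten T f g \<in> Tr (A \<odot> D) (B \<odot> E)"
    and swap_Tr [rule_format]: "\<forall>A B. o_swap T A B \<in> Tr (A \<odot> B) (B \<odot> A)"
    and seq_id [rule_format]:
      "\<forall>A B f. f \<in> Tr A B \<longrightarrow> o_seq T (o_id T B) f = f \<and> o_seq T f (o_id T A) = f"
    and seq_assoc [rule_format]:
      "\<forall>A B D E f g h. f \<in> Tr A B \<longrightarrow> g \<in> Tr B D \<longrightarrow> h \<in> Tr D E \<longrightarrow>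
        o_seq T h (o_seq T g f) = o_seq T (o_seq T h g) f"
    and ten_id [rule_format]: "\<forall>A B. o_ten T (o_id T A) (o_id T B) = o_id T (A \<odot> B)"
    and interchange [rule_format]:
      "\<forall>A B D E F G f f' g g'. f \<in> Tr A B \<longrightarrow> f' \<in> Tr B D \<longrightarrow>
        g \<in> Tr E F \<longrightarrow> g' \<in> Tr F G \<longrightarrow>
        o_ten T (o_seq T f' f) (o_seq T g' g) = o_seq T (o_ten T f' g') (o_ten T f g)"
    and ten_assoc [rule_format]:
      "\<forall>A B D E F G f g h. f \<in> Tr A B \<longrightarrow> g \<in> Tr D E \<longrightarrow> h \<in> Tr F G \<longrightarrow>
        o_ten T (o_ten T f g) h = o_ten T f (o_ten T g h)"
    and ten_unit [rule_format]:
      "\<forall>A B f. f \<in> Tr A B \<longrightarrow> o_ten T f (o_id T \<I>) = f \<and> o_ten T (o_id T \<I>) f = f"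
    and swap_swap [rule_format]:
      "\<forall>A B. o_seq T (o_swap T B A) (o_swap T A B) = o_id T (A \<odot> B)"
    and swap_natural [rule_format]:
      "\<forall>A B D E f g. f \<in> Tr A B \<longrightarrow> g \<in> Tr D E \<longrightarrow>
        o_seq T (o_swap T B E) (o_ten T f g) = o_seq T (o_ten T g f) (o_swap T A D)"
    and seq_bilinear: "bilinear (o_seq T)"
    and ten_bilinear: "bilinear (o_ten T)"
    and id_unit_nonzero: "o_id T \<I> \<noteq> 0"
    and scalars: "Tr \<I> \<I> \<subseteq> {c *\<^sub>R o_id T \<I> | c. 0 \<le> c \<and> c \<le> 1}"
  using framework unfolding OPT_framework_def by - (elim conjE, assumption)+

declare sys_unit [THEN conjunct1, simp] sys_unit [THEN conjunct2, simp]

lemma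
  shows test_Tr [rule_format]: "\<forall>A B ts. ts \<in> Tests A B \<longrightarrow> ts \<noteq> [] \<and> set ts \<subseteq> Tr A B"
    and ex_test [rule_format]: "\<forall>A B f. f \<in> Tr A B \<longrightarrow> (\<exists>ts\<in>Tests A B. f \<in> set ts)"
    and scalar_test [rule_format]: "\<forall>ps. ps \<in> Tests \<I> \<I> \<longrightarrow> sum_list ps = o_id T \<I>"
    and id_test [rule_format]: "\<forall>A. [o_id T A] \<in> Tests A A"
    and swap_test [rule_format]: "\<forall>A B. [o_swap T A B] \<in> Tests (A \<odot> B) (B \<odot> A)"
    and seq_test [rule_format]:
      "\<forall>A B D ts us. ts \<in> Tests A B \<longrightarrow> us \<in> Tests B D \<longrightarrow>
        [o_seq T u t. t \<leftarrow> ts, u \<leftarrow> us] \<in> Tests A D"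
    and ten_test [rule_format]:
      "\<forall>A B D E ts us. ts \<in> Tests A B \<longrightarrow> us \<in> Tests D E \<longrightarrow>
        [o_ten T t u. t \<leftarrow> ts, u \<leftarrow> us] \<in> Tests (A \<odot> D) (B \<odot> E)"
    and coarse_graining_surj [rule_format]:
      "\<forall>A B ts (f::nat \<Rightarrow> nat) m. ts \<in> Tests A B \<longrightarrow>
        (\<forall>i<length ts. f i < m) \<longrightarrow> (\<forall>k<m. \<exists>i<length ts. f i = k) \<longrightarrow>
        map (\<lambda>k. \<Sum>i\<in>{i. i < length ts \<and> f i = k}. ts ! i) [0..<m] \<in> Tests A B"
    and conditioning [rule_format]:
      "\<forall>A B D ts (us::nat \<Rightarrow> 't list). ts \<in> Tests A B \<longrightarrow>
        (\<forall>i<length ts. us i \<in> Tests B D) \<longrightarrow>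
        concat (map (\<lambda>i. map (\<lambda>u. o_seq T u (ts ! i)) (us i)) [0..<length ts]) \<in> Tests A D"
    and effect_eqI [rule_format]:
      "\<forall>A a b. a \<in> effects T A \<longrightarrow> b \<in> effects T A \<longrightarrow>
        (\<forall>\<rho>\<in>states T A. prob T a \<rho> = prob T b \<rho>) \<longrightarrow> a = b"
    and transformation_eqI [rule_format]:
      "\<forall>A B f g. f \<in> Tr A B \<longrightarrow> g \<in> Tr A B \<longrightarrow>
        (\<forall>S. \<forall>\<rho>\<in>states T (A \<odot> S).
            o_seq T (o_ten T f (o_id T S)) \<rho> = o_seq T (o_ten T g (o_id T S)) \<rho>) \<longrightarrow> f = g"
    and states_finite_dim [rule_format]: "\<forall>A. \<exists>F. finite F \<and> states T A \<subseteq> span F"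
    and ex1_det_eff [rule_format]: "\<forall>A. \<exists>!a. [a] \<in> Tests A \<I>"
    and det_eff_ten [rule_format]:
      "\<forall>A B. det_eff T (A \<odot> B) = o_ten T (det_eff T A) (det_eff T B)"
    and local_discriminability [rule_format]:
      "\<forall>A B \<rho> \<sigma>. \<rho> \<in> states T (A \<odot> B) \<longrightarrow> \<sigma> \<in> states T (A \<odot> B) \<longrightarrow> \<rho> \<noteq> \<sigma> \<longrightarrow>
        (\<exists>a\<in>effects T A. \<exists>b\<in>effects T B. prob T (o_ten T a b) \<rho> \<noteq> prob T (o_ten T a b) \<sigma>)"
    and not_deterministic:
      "\<exists>A a \<rho>. a \<in> effects T A \<and> \<rho> \<in> states T A \<and> prob T a \<rho> \<noteq> 0 \<and> prob T a \<rho> \<noteq> 1"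
    and distinguishable:
      "\<exists>A \<rho>1 \<rho>2 a1 a2. \<rho>1 \<in> norm_states T A \<and> \<rho>2 \<in> norm_states T A \<and>
        [a1, a2] \<in> Tests A \<I> \<and> prob T a1 \<rho>1 = 1 \<and> prob T a2 \<rho>2 = 1"
  using framework unfolding OPT_framework_def by - (elim conjE, assumption)+

subsection \<open>Tests, refinements and channels\<close>

lemmas seq_linear [simp] =
  bilinear_ladd [OF seq_bilinear] bilinear_radd [OF seq_bilinear]
  bilinear_lmul [OF seq_bilinear] bilinear_rmul [OF seq_bilinear]
  bilinear_lzero [OF seq_bilinear] bilinear_rzero [OF seq_bilinear]

lemmas ten_linear [simp] =
  bilinear_ladd [OF ten_bilinear] bilinear_radd [OF ten_bilinear]
  bilinear_lmul [OF ten_bilinear] bilinear_rmul [OF ten_bilinear]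
  bilinear_lzero [OF ten_bilinear] bilinear_rzero [OF ten_bilinear]

lemma seq_sum_list:
  "o_seq T (sum_list ts) x = sum_list (map (\<lambda>t. o_seq T t x) ts)"
  "o_seq T x (sum_list ts) = sum_list (map (o_seq T x) ts)"
  by (induction ts) auto

lemma prob_eq: "o_seq T a \<rho> = c *\<^sub>R o_id T \<I> \<Longrightarrow> prob T a \<rho> = c"
  unfolding prob_def using id_unit_nonzero by (intro the_equality) auto

lemma
  assumes "a \<in> Tr A \<I>" "\<rho> \<in> Tr \<I> A"
  shows seq_effect_state: "o_seq T a \<rho> = prob T a \<rho> *\<^sub>R o_id T \<I>"
    and prob_nonneg: "0 \<le> prob T a \<rho>"
    and prob_le_1: "prob T a \<rho> \<le> 1"
proof -
  have "o_seq T a \<rho> \<in> Tr \<I> \<I>"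
    using assms by (rule seq_Tr [rotated])
  then obtain c where c: "o_seq T a \<rho> = c *\<^sub>R o_id T \<I>" "0 \<le> c" "c \<le> 1"
    using scalars by blast
  then show "o_seq T a \<rho> = prob T a \<rho> *\<^sub>R o_id T \<I>" "0 \<le> prob T a \<rho>" "prob T a \<rho> \<le> 1"
    using prob_eq [OF c(1)] by auto
qed

lemma effect_ext:
  assumes "a \<in> Tr A \<I>" "b \<in> Tr A \<I>"
    and "\<And>\<rho>. \<rho> \<in> Tr \<I> A \<Longrightarrow> o_seq T a \<rho> = o_seq T b \<rho>"
  shows "a = b"
  using assms by (intro effect_eqI) (auto simp: effects_def states_def prob_def)

lemma bipartite_state_ext:
  assumes "\<rho> \<in> Tr \<I> (A \<odot> B)" "\<sigma> \<in> Tr \<I> (A \<odot> B)"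
    and "\<And>a b. a \<in> Tr A \<I> \<Longrightarrow> b \<in> Tr B \<I> \<Longrightarrow> o_seq T (o_ten T a b) \<rho> = o_seq T (o_ten T a b) \<sigma>"
  shows "\<rho> = \<sigma>"
  using local_discriminability [of \<rho> A B \<sigma>] assms
  by (auto simp: effects_def states_def prob_def)

text \<open>This is local discriminability with a trivial second factor: a product effect on
  \<open>A \<odot> \<I>\<close> is itself an effect on \<open>A\<close>.\<close>

lemma state_ext:
  assumes "\<rho> \<in> Tr \<I> A" "\<sigma> \<in> Tr \<I> A"
    and "\<And>a. a \<in> Tr A \<I> \<Longrightarrow> o_seq T a \<rho> = o_seq T a \<sigma>"
  shows "\<rho> = \<sigma>"
  using bipartite_state_ext [of \<rho> A \<I> \<sigma>] assms by (metis sys_unit ten_Tr)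

lemma det_eff_test: "[det_eff T A] \<in> Tests A \<I>"
  unfolding det_eff_def by (rule theI') (rule ex1_det_eff)

lemma det_eff_unique: "[a] \<in> Tests A \<I> \<Longrightarrow> a = det_eff T A"
  using det_eff_test ex1_det_eff by blast

lemma det_eff_Tr: "det_eff T A \<in> Tr A \<I>"
  using test_Tr [OF det_eff_test] by auto

lemma det_eff_unit: "det_eff T \<I> = o_id T \<I>"
  using det_eff_unique [OF id_test] by simp

text \<open>As the deterministic effect of \<open>\<I>\<close> is the identity, preserving
  deterministic effects means having total probability one. Normalized states thereby inherit the
  closure properties of channels.\<close>

lemma norm_states_iff_channel: "\<rho> \<in> norm_states T A \<longleftrightarrow> channel T \<I> A \<rho>"
  using prob_eq [of "det_eff T A" \<rho> 1] seq_effect_state [OF det_eff_Tr, of \<rho> A]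
  by (auto simp: norm_states_def channel_def det_eff_unit states_def)

lemma total_test:
  assumes "ts \<in> Tests A B"
  shows "[sum_list ts] \<in> Tests A B"
proof -
  have "map (\<lambda>k. \<Sum>i\<in>{i. i < length ts \<and> 0 = k}. ts ! i) [0..<1] \<in> Tests A B"
    using assms test_Tr [OF assms] by (intro coarse_graining_surj) auto
  then show ?thesis
    by (simp add: sum_list_sum_nth atLeast0LessThan lessThan_def)
qed

lemma total_effect: "ts \<in> Tests A \<I> \<Longrightarrow> sum_list ts = det_eff T A"
  by (intro det_eff_unique total_test)

text \<open>The effects that discriminate two perfectly distinguishable states sum to the
  deterministic effect, so \<open>a1\<close> has probability zero on \<open>\<rho>2\<close>.\<close>

lemma zero_scalar_Tr: "0 \<in> Tr \<I> \<I>"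
proof -
  obtain A \<rho>1 \<rho>2 a1 a2 where *: "\<rho>2 \<in> norm_states T A" "[a1, a2] \<in> Tests A \<I>" "prob T a2 \<rho>2 = 1"
    using distinguishable by blast
  have mem: "a1 \<in> Tr A \<I>" "a2 \<in> Tr A \<I>" "\<rho>2 \<in> Tr \<I> A"
    using test_Tr [OF *(2)] *(1) by (auto simp: norm_states_def states_def)
  have "o_seq T a1 \<rho>2 + o_seq T a2 \<rho>2 = o_id T \<I>"
    using total_effect [OF *(2)] *(1)
    by (simp add: norm_states_iff_channel channel_def det_eff_unit flip: bilinear_ladd [OF seq_bilinear])
  then have "o_seq T a1 \<rho>2 = 0"
    using seq_effect_state [OF mem(2,3)] *(3) by simp
  then show ?thesis
    using seq_Tr [OF mem(3,1)] by simp
qed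

lemma zero_Tr: "f \<in> Tr A B \<Longrightarrow> 0 \<in> Tr A B"
  using ten_Tr [OF zero_scalar_Tr] by fastforce

text \<open>On a fixed state the probabilities are nonnegative reals with sum zero, so each of them
  vanishes.\<close>

lemma effects_sum_zero:
  assumes "set ts \<subseteq> Tr A \<I>" "sum_list ts = 0" "t \<in> set ts"
  shows "t = 0"
proof -
  have "o_seq T t \<rho> = o_seq T 0 \<rho>" if \<rho>: "\<rho> \<in> Tr \<I> A" for \<rho>
  proof -
    have "sum_list (map (\<lambda>t. prob T t \<rho>) us) *\<^sub>R o_id T \<I> = o_seq T (sum_list us) \<rho>"
      if "set us \<subseteq> Tr A \<I>" for us
      using that by (induction us) (auto simp: scaleR_add_left seq_effect_state [OF _ \<rho>])
    from this [OF assms(1)] have "sum_list (map (\<lambda>t. prob T t \<rho>) ts) = 0"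
      using id_unit_nonzero assms(2) by simp
    then have "prob T t \<rho> = 0"
      using assms(1,3) prob_nonneg [OF _ \<rho>] by (subst (asm) sum_list_nonneg_eq_0_iff) auto
    then show ?thesis
      using seq_effect_state [of t A \<rho>] assms(1,3) \<rho> by auto
  qed
  then show ?thesis
    using assms(1,3) zero_Tr by (intro effect_ext [of t A]) auto
qed

text \<open>Every effect belongs to a test whose total is the deterministic effect, so its value on
  \<open>x\<close> is one of finitely many nonnegative terms with sum zero.\<close>

lemma state_zero:
  assumes "x \<in> Tr \<I> A" "o_seq T (det_eff T A) x = 0"
  shows "x = 0"
proof (rule state_ext [OF assms(1) zero_Tr [OF assms(1)]])
  fix a assume "a \<in> Tr A \<I>"
  then obtain ts where ts: "ts \<in> Tests A \<I>" "a \<in> set ts"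
    using ex_test by blast
  have "sum_list (map (\<lambda>t. o_seq T t x) ts) = 0"
    unfolding seq_sum_list(1) [symmetric] total_effect [OF ts(1)] by (rule assms(2))
  then have "o_seq T a x = 0"
    using ts(2) test_Tr [OF ts(1)] seq_Tr [OF assms(1)]
    by - (rule effects_sum_zero [of "map (\<lambda>t. o_seq T t x) ts" \<I> "o_seq T a x"], auto)
  then show "o_seq T a x = o_seq T a 0"
    by simp
qed

text \<open>Discarding the whole output of \<open>f\<close> extended by an ancilla discards in
  particular the output of \<open>f\<close>, which gives zero. Hence \<open>state_zero\<close>
  annihilates every image state.\<close>

lemma transformation_zero:
  assumes "f \<in> Tr A B" "o_seq T (det_eff T B) f = 0"
  shows "f = 0"
proof (rule transformation_eqI [OF assms(1) zero_Tr [OF assms(1)]])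
  fix S \<rho> assume "\<rho> \<in> states T (A \<odot> S)"
  then have \<rho>: "\<rho> \<in> Tr \<I> (A \<odot> S)"
    by (simp add: states_def)
  have f: "o_ten T f (o_id T S) \<in> Tr (A \<odot> S) (B \<odot> S)"
    using assms(1) id_Tr by (rule ten_Tr)
  have "o_seq T (det_eff T (B \<odot> S)) (o_seq T (o_ten T f (o_id T S)) \<rho>)
      = o_seq T (o_seq T (det_eff T (B \<odot> S)) (o_ten T f (o_id T S))) \<rho>"
    by (rule seq_assoc [OF \<rho> f det_eff_Tr])
  also have "o_seq T (det_eff T (B \<odot> S)) (o_ten T f (o_id T S))
      = o_ten T (o_seq T (det_eff T B) f) (o_seq T (det_eff T S) (o_id T S))"
    unfolding det_eff_ten by (rule interchange [OF assms(1) det_eff_Tr id_Tr det_eff_Tr, symmetric])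
  finally show "o_seq T (o_ten T f (o_id T S)) \<rho> = o_seq T (o_ten T 0 (o_id T S)) \<rho>"
    using state_zero [OF seq_Tr [OF \<rho> f]] assms(2) by simp
qed

text \<open>In a test containing a channel \<open>f\<close>, the other outcomes followed by the
  deterministic effect sum to zero. They vanish by \<open>transformation_zero\<close>, so
  \<open>f\<close> is the total of the test. Closure of channels under the operations then follows
  from closure of tests.\<close>

lemma channel_iff_test: "channel T A B f \<longleftrightarrow> [f] \<in> Tests A B"
proof
  assume f: "channel T A B f"
  then obtain ts where ts: "ts \<in> Tests A B" "f \<in> set ts"
    using ex_test [of f A B] by (auto simp: channel_def)
  define us where "us = remove1 f ts"
  have us: "set us \<subseteq> Tr A B"
    unfolding us_def using test_Tr [OF ts(1)] by (meson set_remove1_subset subset_trans)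
  have sum: "sum_list ts = f + sum_list us"
    using ts(2) by (simp add: us_def sum_list_map_remove1 [where f = id, simplified])
  have "[o_seq T (det_eff T B) (sum_list ts)] \<in> Tests A \<I>"
    using seq_test [OF total_test [OF ts(1)] det_eff_test] by simp
  then have "o_seq T (det_eff T B) (sum_list ts) = det_eff T A"
    by (rule det_eff_unique)
  then have "sum_list (map (o_seq T (det_eff T B)) us) = 0"
    using f by (simp add: sum channel_def seq_sum_list(2))
  then have "o_seq T (det_eff T B) u = 0" if "u \<in> set us" for u
    using us that seq_Tr [OF _ det_eff_Tr]
    by - (rule effects_sum_zero [of "map (o_seq T (det_eff T B)) us" A], auto)
  then have "u = 0" if "u \<in> set us" for u
    using transformation_zero [of u A B] us that by auto
  then have "sum_list us = 0"
    by (induction us) auto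
  then show "[f] \<in> Tests A B"
    using total_test [OF ts(1)] sum by simp
next
  assume f: "[f] \<in> Tests A B"
  then have "[o_seq T (det_eff T B) f] \<in> Tests A \<I>"
    using seq_test [OF f det_eff_test] by simp
  then show "channel T A B f"
    using f test_Tr [OF f] det_eff_unique by (simp add: channel_def)
qed

lemma channel_Tr: "channel T A B f \<Longrightarrow> f \<in> Tr A B"
  by (simp add: channel_def)

lemma channel_id: "channel T A A (o_id T A)"
  and channel_swap: "channel T (A \<odot> B) (B \<odot> A) (o_swap T A B)"
  and channel_det_eff: "channel T A \<I> (det_eff T A)"
  by (simp_all add: channel_iff_test id_test swap_test det_eff_test)

lemma channel_seq: "channel T A B f \<Longrightarrow> channel T B D g \<Longrightarrow> channel T A D (o_seq T g f)"
  unfolding channel_iff_test using seq_test [of "[f]" A B "[g]"] by simp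

lemma channel_ten:
  "channel T A B f \<Longrightarrow> channel T D E g \<Longrightarrow> channel T (A \<odot> D) (B \<odot> E) (o_ten T f g)"
  unfolding channel_iff_test using ten_test [of "[f]" A B "[g]"] by simp

text \<open>Since \<open>a1\<close> and \<open>a2\<close> sum to the deterministic effect, certainty
  of \<open>a2\<close> on \<open>\<phi>2\<close> forces \<open>a1\<close> to vanish there. The two
  states later serve as flags in \<open>steering\<close>.\<close>

lemma ex_distinguishable:
  obtains X \<phi>1 \<phi>2 a1 a2 where "channel T \<I> X \<phi>1" "channel T \<I> X \<phi>2" "[a1, a2] \<in> Tests X \<I>"
    "a1 \<in> Tr X \<I>" "a2 \<in> Tr X \<I>"
    "o_seq T a1 \<phi>1 = o_id T \<I>" "o_seq T a1 \<phi>2 = 0" "o_seq T a2 \<phi>2 = o_id T \<I>"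
proof -
  obtain X \<phi>1 \<phi>2 a1 a2 where *: "channel T \<I> X \<phi>1" "channel T \<I> X \<phi>2" "[a1, a2] \<in> Tests X \<I>"
    "prob T a1 \<phi>1 = 1" "prob T a2 \<phi>2 = 1"
    using distinguishable unfolding norm_states_iff_channel by blast
  have mem: "a1 \<in> Tr X \<I>" "a2 \<in> Tr X \<I>" "\<phi>1 \<in> Tr \<I> X" "\<phi>2 \<in> Tr \<I> X"
    using test_Tr [OF *(3)] * by (auto dest: channel_Tr)
  have "o_seq T a1 \<phi>1 = o_id T \<I>" and a2: "o_seq T a2 \<phi>2 = o_id T \<I>"
    using seq_effect_state [OF mem(1,3)] seq_effect_state [OF mem(2,4)] *(4,5) by simp_all
  moreover have "o_seq T a1 \<phi>2 + o_seq T a2 \<phi>2 = o_id T \<I>"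
    using total_effect [OF *(3)] *(2) by (simp add: channel_def det_eff_unit flip: bilinear_ladd [OF seq_bilinear])
  ultimately show ?thesis
    using that * mem by simp
qed

lemma zero_test: "[0, o_id T \<I>] \<in> Tests \<I> \<I>"
proof -
  obtain X \<phi>1 \<phi>2 a1 a2 where *: "channel T \<I> X \<phi>2" "[a1, a2] \<in> Tests X \<I>"
    "o_seq T a1 \<phi>2 = 0" "o_seq T a2 \<phi>2 = o_id T \<I>"
    by (rule ex_distinguishable)
  then show ?thesis
    using seq_test [of "[\<phi>2]" \<I> X "[a1, a2]"] by (simp add: channel_iff_test)
qed

text \<open>Tensoring with the test \<open>[0, o_id T \<I>]\<close> prepends a block of zeros as
  long as the whole list, so iteration yields arbitrarily many zero outcomes.\<close>

lemma pad_test: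
  assumes "ts \<in> Tests A B"
  shows "\<exists>k\<ge>m. replicate k 0 @ ts \<in> Tests A B"
proof (induction m)
  case 0
  then show ?case
    using assms by (intro exI [of _ 0]) simp
next
  case (Suc m)
  then obtain k where k: "k \<ge> m" "replicate k 0 @ ts \<in> Tests A B"
    by blast
  have "[o_ten T t u. t \<leftarrow> [0, o_id T \<I>], u \<leftarrow> replicate k 0 @ ts] \<in> Tests (\<I> \<odot> A) (\<I> \<odot> B)"
    by (rule ten_test [OF zero_test k(2)])
  moreover have "map (o_ten T (o_id T \<I>)) ts = ts"
    using test_Tr [OF assms] ten_unit by (intro map_idI) blast
  moreover have "map (o_ten T 0) ts = replicate (length ts) 0"
    by (simp add: list_eq_iff_nth_eq)
  ultimately have "replicate (k + length ts + k) 0 @ ts \<in> Tests A B"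
    by (simp add: replicate_add)
  \<comment> \<open>Nonemptiness of \<open>ts\<close> makes the new padding strictly longer than the
    old one.\<close>
  then show ?case
    using k(1) test_Tr [OF assms]
    by (intro exI [of _ "k + length ts + k"]) (cases ts; simp)
qed

text \<open>Padding with zero outcomes removes the surjectivity requirement on the partition map.\<close>

lemma coarse_graining:
  assumes ts: "ts \<in> Tests A B" and f: "\<And>i. i < length ts \<Longrightarrow> f i < m"
  shows "map (\<lambda>k. \<Sum>i\<in>{i. i < length ts \<and> f i = k}. ts ! i) [0..<m] \<in> Tests A B"
proof -
  obtain k where k: "k \<ge> m" and test: "replicate k 0 @ ts \<in> Tests A B"
    using pad_test [OF ts] by blast
  define us where "us = replicate k 0 @ ts"
  \<comment> \<open>The first \<open>m\<close> zeros hit every block once, surplus zeros go to block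
    \<open>0\<close>, and the genuine outcomes follow \<open>f\<close> after a shift by
    \<open>k\<close>. Only zeros are added to the block sums.\<close>
  define g where "g i = (if i < k then if i < m then i else 0 else f (i - k))" for i
  have "0 < m"
    using f [of 0] test_Tr [OF ts] by (cases m) auto
  have "(\<Sum>i\<in>{i. i < length us \<and> g i = j}. us ! i) = (\<Sum>i\<in>{i. i < length ts \<and> f i = j}. ts ! i)" for j
  proof -
    have "(\<Sum>i\<in>{i. i < length us \<and> g i = j}. us ! i)
        = (\<Sum>i\<in>(\<lambda>i. i + k) ` {i. i < length ts \<and> f i = j}. us ! i)"
    proof (rule sum.mono_neutral_right)
      show "\<forall>i\<in>{i. i < length us \<and> g i = j} - (\<lambda>i. i + k) ` {i. i < length ts \<and> f i = j}. us ! i = 0"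
      proof
        fix i assume i: "i \<in> {i. i < length us \<and> g i = j} - (\<lambda>i. i + k) ` {i. i < length ts \<and> f i = j}"
        have "i < k"
        proof (rule ccontr)
          assume "\<not> i < k"
          then have "i = (i - k) + k" "i - k < length ts" "f (i - k) = j"
            using i by (auto simp: us_def g_def)
          then show False
            using i by blast
        qed
        then show "us ! i = 0"
          by (simp add: us_def nth_append)
      qed
    qed (auto simp: us_def g_def)
    also have "\<dots> = (\<Sum>i\<in>{i. i < length ts \<and> f i = j}. ts ! i)"
      by (subst sum.reindex) (auto simp: us_def nth_append)
    finally show ?thesis .
  qed
  moreover have "map (\<lambda>j. \<Sum>i\<in>{i. i < length us \<and> g i = j}. us ! i) [0..<m] \<in> Tests A B"
  proof (rule coarse_graining_surj)
    show "us \<in> Tests A B"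
      by (simp add: us_def test)
    show "g i < m" if "i < length us" for i
      using that f \<open>0 < m\<close> by (auto simp: g_def us_def)
    show "\<exists>i<length us. g i = j" if "j < m" for j
      using that k by (intro exI [of _ j]) (auto simp: g_def us_def)
  qed
  ultimately show ?thesis
    by simp
qed

text \<open>A three-outcome normal form: the outcome \<open>D\<close>, the rest of \<open>C\<close>,
  and everything outside \<open>C\<close>. The last two blocks may be empty, so the partition map
  need not be surjective.\<close>

lemma refines_iff:
  "refines T A B D C \<longleftrightarrow> (\<exists>D' D''. [D, D', D''] \<in> Tests A B \<and> C = D + D')"
proof
  assume "refines T A B D C"
  then obtain ds Y j where *: "ds \<in> Tests A B" "Y \<subseteq> {..<length ds}" "C = (\<Sum>j\<in>Y. ds ! j)"
    "j \<in> Y" "D = ds ! j"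
    unfolding refines_def by blast
  define f :: "nat \<Rightarrow> nat" where "f i = (if i = j then 0 else if i \<in> Y then 1 else 2)" for i
  have "map (\<lambda>k. \<Sum>i\<in>{i. i < length ds \<and> f i = k}. ds ! i) [0..<3] \<in> Tests A B"
    by (rule coarse_graining [OF *(1)]) (simp add: f_def)
  moreover have "{i. i < length ds \<and> f i = 0} = {j}" "{i. i < length ds \<and> f i = 1} = Y - {j}"
    using *(2,4) by (auto simp: f_def)
  moreover have "C = ds ! j + (\<Sum>i\<in>Y - {j}. ds ! i)"
    using * finite_subset [OF *(2)] by (simp add: sum.remove)
  ultimately show "\<exists>D' D''. [D, D', D''] \<in> Tests A B \<and> C = D + D'"
    using *(5) by (simp add: upt_rec numeral_eq_Suc) metis
next
  assume "\<exists>D' D''. [D, D', D''] \<in> Tests A B \<and> C = D + D'"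
  then obtain D' D'' where "[D, D', D''] \<in> Tests A B" "C = D + D'"
    by blast
  then show "refines T A B D C"
    unfolding refines_def
    by (intro exI [of _ "[D, D', D'']"] exI [of _ "{0, 1}"]) auto
qed

lemma ex_two_outcome_test:
  assumes "f \<in> Tr A B"
  obtains f' where "[f, f'] \<in> Tests A B" "f' \<in> Tr A B"
proof -
  obtain ts j where ts: "ts \<in> Tests A B" "j < length ts" "f = ts ! j"
    using ex_test [OF assms] by (metis in_set_conv_nth)
  define g :: "nat \<Rightarrow> nat" where "g i = (if i = j then 0 else 1)" for i
  have "map (\<lambda>k. \<Sum>i\<in>{i. i < length ts \<and> g i = k}. ts ! i) [0..<2] \<in> Tests A B"
    by (rule coarse_graining [OF ts(1)]) (simp add: g_def)
  moreover have "{i. i < length ts \<and> g i = 0} = {j}"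
    using ts(2) by (auto simp: g_def)
  ultimately have "[f, \<Sum>i\<in>{i. i < length ts \<and> g i = 1}. ts ! i] \<in> Tests A B"
    using ts(3) by (simp add: upt_rec numeral_eq_Suc)
  with that test_Tr [OF this] show ?thesis
    by auto
qed

text \<open>Either \<open>f\<close> or \<open>f'\<close> may follow each of the two outcomes that
  make up \<open>C\<close>; these four outcomes sum to \<open>f + f'\<close> applied to
  \<open>C\<close>.\<close>

lemma refines_seq:
  assumes "refines T A B D C" "[f, f'] \<in> Tests B E"
  shows "refines T A E (o_seq T f D) (o_seq T (f + f') C)"
proof -
  obtain D' D'' where D: "[D, D', D''] \<in> Tests A B" "C = D + D'"
    using assms(1) refines_iff by blast
  let ?ts = "[o_seq T u t. t \<leftarrow> [D, D', D''], u \<leftarrow> [f, f']]"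
  have "?ts \<in> Tests A E"
    by (rule seq_test [OF D(1) assms(2)])
  moreover have "o_seq T (f + f') C = (\<Sum>j\<in>{0, 1, 2, 3}. ?ts ! j)"
    by (simp add: D(2))
  moreover have "o_seq T f D = ?ts ! 0"
    by simp
  moreover have "{0, 1, 2, 3} \<subseteq> {..<length ?ts}"
    by simp
  ultimately show ?thesis
    unfolding refines_def by blast
qed

lemma refines_Tr: "refines T A B D C \<Longrightarrow> D \<in> Tr A B"
  unfolding refines_iff by (auto dest: test_Tr)

lemma refines_channel_seq:
  assumes "refines T A B D C" "channel T B E f"
  shows "refines T A E (o_seq T f D) (o_seq T f C)"
proof -
  obtain D' D'' where D: "[D, D', D''] \<in> Tests A B" "C = D + D'"
    using assms(1) refines_iff by blast
  have "[o_seq T f D, o_seq T f D', o_seq T f D''] \<in> Tests A E"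
    using seq_test [OF D(1), of "[f]"] assms(2) by (simp add: channel_iff_test)
  then show ?thesis
    unfolding refines_iff using D(2) by auto
qed

text \<open>Completing \<open>b\<close> to a test \<open>[b, b']\<close> with total
  \<open>det_eff T B\<close> makes conditioning on \<open>b\<close> one branch of discarding
  \<open>B\<close>. This is the easy converse of \<open>steering\<close>.\<close>

lemma refines_marginal:
  assumes "refines T \<I> (A \<odot> B) D \<tau>" "b \<in> Tr B \<I>"
  shows "refines T \<I> A (o_seq T (o_ten T (o_id T A) b) D) (marginal T A B \<tau>)"
proof -
  obtain b' where b': "[b, b'] \<in> Tests B \<I>"
    using ex_two_outcome_test [OF assms(2)] .
  have "[o_ten T (o_id T A) b, o_ten T (o_id T A) b'] \<in> Tests (A \<odot> B) A"
    using ten_test [OF id_test b', of A] by simp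
  from refines_seq [OF assms(1) this] show ?thesis
    using total_effect [OF b'] by (simp add: marginal_def flip: bilinear_radd [OF ten_bilinear])
qed

lemma refines_self: "channel T A B f \<Longrightarrow> refines T A B f f"
  unfolding refines_def channel_iff_test by (intro exI [of _ "[f]"] exI [of _ "{0}"]) auto

subsection \<open>Typed transformations\<close>

definition arr :: "('s, 't) arrow \<Rightarrow> bool" where
  "arr f \<longleftrightarrow> mor f \<in> Tr (src f) (tgt f)"

definition chan :: "('s, 't) arrow \<Rightarrow> bool" where
  "chan f \<longleftrightarrow> channel T (src f) (tgt f) (mor f)"

definition comp :: "('s, 't) arrow \<Rightarrow> ('s, 't) arrow \<Rightarrow> ('s, 't) arrow" (infixr "\<cdot>" 70) where
  "g \<cdot> f = Arrow (src f) (o_seq T (mor g) (mor f)) (tgt g)"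

definition tens :: "('s, 't) arrow \<Rightarrow> ('s, 't) arrow \<Rightarrow> ('s, 't) arrow" (infixr "\<otimes>" 75) where
  "f \<otimes> g = Arrow (src f \<odot> src g) (o_ten T (mor f) (mor g)) (tgt f \<odot> tgt g)"

definition ident :: "'s \<Rightarrow> ('s, 't) arrow" where
  "ident A = Arrow A (o_id T A) A"

definition swp :: "'s \<Rightarrow> 's \<Rightarrow> ('s, 't) arrow" where
  "swp A B = Arrow (A \<odot> B) (o_swap T A B) (B \<odot> A)"

definition discard :: "'s \<Rightarrow> ('s, 't) arrow" where
  "discard A = Arrow A (det_eff T A) \<I>"

lemma arrow_projections [simp]:
  "src (g \<cdot> f) = src f" "tgt (g \<cdot> f) = tgt g" "mor (g \<cdot> f) = o_seq T (mor g) (mor f)"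
  "src (f \<otimes> g) = src f \<odot> src g" "tgt (f \<otimes> g) = tgt f \<odot> tgt g" "mor (f \<otimes> g) = o_ten T (mor f) (mor g)"
  "src (ident A) = A" "tgt (ident A) = A" "mor (ident A) = o_id T A"
  "src (swp A B) = A \<odot> B" "tgt (swp A B) = B \<odot> A" "mor (swp A B) = o_swap T A B"
  "src (discard A) = A" "tgt (discard A) = \<I>" "mor (discard A) = det_eff T A"
  by (simp_all add: comp_def tens_def ident_def swp_def discard_def)

lemma chan_arr: "chan f \<Longrightarrow> arr f"
  by (simp add: arr_def chan_def channel_def)

lemma chan_basic [simp]:
  "chan (ident A)" "chan (swp A B)" "chan (discard A)"
  "chan f \<Longrightarrow> chan g \<Longrightarrow> tgt f = src g \<Longrightarrow> chan (g \<cdot> f)"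
  "chan f \<Longrightarrow> chan g \<Longrightarrow> chan (f \<otimes> g)"
  by (simp_all add: chan_def channel_id channel_swap channel_det_eff channel_ten)
     (metis channel_seq)

lemma arr_basic [simp]:
  "arr (ident A)" "arr (swp A B)" "arr (discard A)"
  "arr f \<Longrightarrow> arr g \<Longrightarrow> tgt f = src g \<Longrightarrow> arr (g \<cdot> f)"
  "arr f \<Longrightarrow> arr g \<Longrightarrow> arr (f \<otimes> g)"
  by (simp_all add: chan_arr) (simp_all add: arr_def ten_Tr, metis seq_Tr)

lemma comp_assoc [simp]:
  "arr f \<Longrightarrow> arr g \<Longrightarrow> arr h \<Longrightarrow> tgt f = src g \<Longrightarrow> tgt g = src h \<Longrightarrow> (h \<cdot> g) \<cdot> f = h \<cdot> (g \<cdot> f)"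
  by (rule arrow.expand) (auto simp: arr_def seq_assoc)

lemma tens_assoc [simp]:
  "arr f \<Longrightarrow> arr g \<Longrightarrow> arr h \<Longrightarrow> (f \<otimes> g) \<otimes> h = f \<otimes> (g \<otimes> h)"
  by (rule arrow.expand) (auto simp: arr_def ten_assoc)

lemma tens_comp [simp]:
  assumes "arr f" "arr f'" "arr g" "arr g'" "tgt f = src f'" "tgt g = src g'"
  shows "(f' \<otimes> g') \<cdot> (f \<otimes> g) = (f' \<cdot> f) \<otimes> (g' \<cdot> g)"
  using assms by (intro arrow.expand) (auto simp: arr_def interchange)

text \<open>Since \<open>comp_assoc\<close> nests compositions to the right, two adjacent tensors
  are often followed by a further factor; this variant lets the simplifier still fuse them.\<close>

lemma tens_comp_comp [simp]:
  assumes "arr f" "arr f'" "arr g" "arr g'" "arr h" "tgt f = src f'" "tgt g = src g'"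
    and "tgt h = src f \<odot> src g"
  shows "(f' \<otimes> g') \<cdot> (f \<otimes> g) \<cdot> h = ((f' \<cdot> f) \<otimes> (g' \<cdot> g)) \<cdot> h"
  using assms tens_comp [of f f' g g'] by (simp del: tens_comp flip: comp_assoc)

lemma ident_tens [simp]: "ident (A \<odot> B) = ident A \<otimes> ident B"
  by (rule arrow.expand) (auto simp: ten_id)

lemma discard_tens [simp]: "discard (A \<odot> B) = discard A \<otimes> discard B"
  by (rule arrow.expand) (auto simp: det_eff_ten)

lemma discard_unit [simp]: "discard \<I> = ident \<I>"
  by (rule arrow.expand) (auto simp: det_eff_unit)

lemma ident_comp [simp]:
  "arr f \<Longrightarrow> tgt f = B \<Longrightarrow> ident B \<cdot> f = f"
  "arr f \<Longrightarrow> src f = A \<Longrightarrow> f \<cdot> ident A = f"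
  by (rule arrow.expand; auto simp: arr_def seq_id)+

text \<open>Composite identities are split by \<open>ident_tens\<close> and so no longer match
  \<open>ident_comp\<close>; these variants restore the cancellation.\<close>

lemma ident_tens_comp [simp]:
  "arr f \<Longrightarrow> tgt f = A \<odot> B \<Longrightarrow> (ident A \<otimes> ident B) \<cdot> f = f"
  "arr f \<Longrightarrow> tgt f = A \<odot> B \<odot> D \<Longrightarrow> (ident A \<otimes> ident B \<otimes> ident D) \<cdot> f = f"
  "arr f \<Longrightarrow> src f = A \<odot> B \<Longrightarrow> f \<cdot> (ident A \<otimes> ident B) = f"
  using ident_comp(1) [of f "A \<odot> B"] ident_comp(1) [of f "A \<odot> B \<odot> D"] ident_comp(2) [of f "A \<odot> B"]
  by simp_all

lemma tens_unit [simp]: "arr f \<Longrightarrow> f \<otimes> ident \<I> = f" "arr f \<Longrightarrow> ident \<I> \<otimes> f = f"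
  by (rule arrow.expand; auto simp: arr_def ten_unit)+

lemma discard_comp [simp]: "chan f \<Longrightarrow> tgt f = B \<Longrightarrow> discard B \<cdot> f = discard (src f)"
  by (rule arrow.expand) (auto simp: chan_def channel_def)

lemma discard_tens_comp [simp]:
  "chan f \<Longrightarrow> tgt f = A \<odot> B \<Longrightarrow> (discard A \<otimes> discard B) \<cdot> f = discard (src f)"
  using discard_comp [of f "A \<odot> B"] by simp

lemma swp_swp [simp]: "swp B A \<cdot> swp A B = ident A \<otimes> ident B"
  by (rule arrow.expand) (auto simp: swap_swap ten_id)

lemma swp_swp_comp [simp]: "arr f \<Longrightarrow> tgt f = A \<odot> B \<Longrightarrow> swp B A \<cdot> swp A B \<cdot> f = f"
  by (simp flip: comp_assoc)

lemma swp_natural: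
  "arr f \<Longrightarrow> arr g \<Longrightarrow> tgt f = B \<Longrightarrow> tgt g = E \<Longrightarrow>
    swp B E \<cdot> (f \<otimes> g) = (g \<otimes> f) \<cdot> swp (src f) (src g)"
  by (rule arrow.expand) (auto simp: arr_def swap_natural)

text \<open>The swap of two trivial systems is a nonnegative scalar whose square is one.\<close>

lemma swp_unit_unit [simp]: "swp \<I> \<I> = ident \<I>"
proof -
  obtain c where c: "o_swap T \<I> \<I> = c *\<^sub>R o_id T \<I>" "0 \<le> c"
    using scalars swap_Tr [of \<I> \<I>] by auto
  then have "(c * c) *\<^sub>R o_id T \<I> = 1 *\<^sub>R o_id T \<I>"
    using swap_swap [of \<I> \<I>] seq_id [OF id_Tr] by simp
  then have "c * c = 1"
    using id_unit_nonzero scaleR_cancel_right by blast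
  then have "c = 1"
    using c(2) square_eq_1_iff [of c] by auto
  then show ?thesis
    using c(1) by (intro arrow.expand) simp
qed

lemma tens_eq_comp_right: "arr f \<Longrightarrow> arr b \<Longrightarrow> tgt b = \<I> \<Longrightarrow> f \<otimes> b = f \<cdot> (ident (src f) \<otimes> b)"
  using tens_comp [of "ident (src f)" f b "ident \<I>"] by simp

lemma tens_eq_comp_left: "arr f \<Longrightarrow> arr a \<Longrightarrow> tgt a = \<I> \<Longrightarrow> a \<otimes> f = f \<cdot> (a \<otimes> ident (src f))"
  using tens_comp [of a "ident \<I>" "ident (src f)" f] by simp

lemma tens_state_right: "arr f \<Longrightarrow> arr \<rho> \<Longrightarrow> src \<rho> = \<I> \<Longrightarrow> f \<otimes> \<rho> = (ident (tgt f) \<otimes> \<rho>) \<cdot> f"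
  using tens_comp [of f "ident (tgt f)" "ident \<I>" \<rho>] by simp

section \<open>Extensionality of typed transformations\<close>

lemma state_arrow_ext:
  assumes "arr f" "arr g" "src f = \<I>" "src g = \<I>" "tgt f = A \<odot> B" "tgt g = A \<odot> B"
    and "\<And>a b. arr a \<Longrightarrow> arr b \<Longrightarrow> src a = A \<Longrightarrow> src b = B \<Longrightarrow> tgt a = \<I> \<Longrightarrow> tgt b = \<I> \<Longrightarrow>
      (a \<otimes> b) \<cdot> f = (a \<otimes> b) \<cdot> g"
  shows "f = g"
proof -
  have "mor f = mor g"
  proof (rule bipartite_state_ext)
    show "mor f \<in> Tr \<I> (A \<odot> B)" "mor g \<in> Tr \<I> (A \<odot> B)"
      using assms(1-6) by (simp_all add: arr_def)
    show "o_seq T (o_ten T a b) (mor f) = o_seq T (o_ten T a b) (mor g)"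
      if "a \<in> Tr A \<I>" "b \<in> Tr B \<I>" for a b
      using assms(7) [of "Arrow A a \<I>" "Arrow B b \<I>"] that
      by (simp add: arr_def comp_def)
  qed
  then show ?thesis
    using assms by (intro arrow.expand) simp
qed

lemma arrow_ext_ancilla:
  assumes "arr f" "arr g" "src f = src g" "tgt f = tgt g"
    and "\<And>S \<rho>. arr \<rho> \<Longrightarrow> src \<rho> = \<I> \<Longrightarrow> tgt \<rho> = src f \<odot> S \<Longrightarrow> (f \<otimes> ident S) \<cdot> \<rho> = (g \<otimes> ident S) \<cdot> \<rho>"
  shows "f = g"
proof -
  have "mor f = mor g"
  proof (rule transformation_eqI)
    show "mor f \<in> Tr (src f) (tgt f)" "mor g \<in> Tr (src f) (tgt f)"
      using assms(1-4) by (simp_all add: arr_def)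
    show "o_seq T (o_ten T (mor f) (o_id T S)) \<rho> = o_seq T (o_ten T (mor g) (o_id T S)) \<rho>"
      if "\<rho> \<in> states T (src f \<odot> S)" for S \<rho>
      using assms(5) [of "Arrow \<I> \<rho> (src f \<odot> S)" S] that
      by (simp add: arr_def comp_def states_def)
  qed
  then show ?thesis
    using assms by (intro arrow.expand) simp
qed

text \<open>Transformations are compared on states with an ancilla \<open>S\<close>. Local
  discriminability is used twice, to split \<open>A\<close> from \<open>B \<odot> S\<close> and then
  \<open>B\<close> from \<open>S\<close>; the effect on \<open>S\<close> slides past the
  transformations, leaving only product effects on their output.\<close>

lemma bipartite_arrow_ext:
  assumes f: "arr f" "tgt f = A \<odot> B" and g: "arr g" "tgt g = A \<odot> B" and s: "src f = src g"
    and eq: "\<And>a b. arr a \<Longrightarrow> arr b \<Longrightarrow> src a = A \<Longrightarrow> src b = B \<Longrightarrow> tgt a = \<I> \<Longrightarrow> tgt b = \<I> \<Longrightarrow>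
      (a \<otimes> b) \<cdot> f = (a \<otimes> b) \<cdot> g"
  shows "f = g"
proof (rule arrow_ext_ancilla)
  fix S \<rho> assume \<rho>: "arr \<rho>" "src \<rho> = \<I>" "tgt \<rho> = src f \<odot> S"
  note [simp] = \<rho> f g s
  have "(a \<otimes> ident (B \<odot> S)) \<cdot> (f \<otimes> ident S) \<cdot> \<rho> = (a \<otimes> ident (B \<odot> S)) \<cdot> (g \<otimes> ident S) \<cdot> \<rho>"
    if [simp]: "arr a" "src a = A" "tgt a = \<I>" for a
  proof (rule state_arrow_ext [of _ _ B S])
    fix b d assume [simp]: "arr b" "arr d" "src b = B" "src d = S" "tgt b = \<I>" "tgt d = \<I>"
    have "(b \<otimes> d) \<cdot> (a \<otimes> ident (B \<odot> S)) \<cdot> (h \<otimes> ident S) \<cdot> \<rho> = (((a \<otimes> b) \<cdot> h) \<otimes> d) \<cdot> \<rho>"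
      if [simp]: "arr h" "tgt h = A \<odot> B" "src h = src f" for h
    proof -
      have "(b \<otimes> d) \<cdot> (a \<otimes> ident (B \<odot> S)) = a \<otimes> b \<otimes> d"
        using tens_eq_comp_left [of "b \<otimes> d" a] by simp
      then have "(b \<otimes> d) \<cdot> (a \<otimes> ident (B \<odot> S)) \<cdot> (h \<otimes> ident S) \<cdot> \<rho>
          = ((a \<otimes> b) \<otimes> d) \<cdot> (h \<otimes> ident S) \<cdot> \<rho>"
        by (simp del: tens_comp tens_comp_comp flip: comp_assoc)
      also have "\<dots> = (((a \<otimes> b) \<cdot> h) \<otimes> d) \<cdot> \<rho>"
        by (simp del: tens_assoc)
      finally show ?thesis .
    qed
    then show "(b \<otimes> d) \<cdot> (a \<otimes> ident (B \<odot> S)) \<cdot> (f \<otimes> ident S) \<cdot> \<rho>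
        = (b \<otimes> d) \<cdot> (a \<otimes> ident (B \<odot> S)) \<cdot> (g \<otimes> ident S) \<cdot> \<rho>"
      using eq [of a b] by (simp del: tens_comp tens_comp_comp ident_tens)
  qed simp_all
  note * = this
  show "(f \<otimes> ident S) \<cdot> \<rho> = (g \<otimes> ident S) \<cdot> \<rho>"
  proof (rule state_arrow_ext [of _ _ A "B \<odot> S"])
    fix a d assume [simp]: "arr a" "arr d" "src a = A" "src d = B \<odot> S" "tgt a = \<I>" "tgt d = \<I>"
    have "(a \<otimes> d) \<cdot> h = d \<cdot> (a \<otimes> ident (B \<odot> S)) \<cdot> h" if [simp]: "arr h" "tgt h = A \<odot> B \<odot> S" for h
      using tens_eq_comp_left [of d a] by (simp del: ident_tens)
    then show "(a \<otimes> d) \<cdot> (f \<otimes> ident S) \<cdot> \<rho> = (a \<otimes> d) \<cdot> (g \<otimes> ident S) \<cdot> \<rho>"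
      using * by (simp del: tens_comp tens_comp_comp ident_tens)
  qed simp_all
qed (use f g s in simp_all)

lemma arrow_ext_effects:
  assumes "arr f" "arr g" "tgt f = tgt g" "src f = src g"
    and "\<And>a. arr a \<Longrightarrow> src a = tgt f \<Longrightarrow> tgt a = \<I> \<Longrightarrow> a \<cdot> f = a \<cdot> g"
  shows "f = g"
proof (rule bipartite_arrow_ext [of f "tgt f" \<I> g])
  show "(a \<otimes> b) \<cdot> f = (a \<otimes> b) \<cdot> g"
    if "arr a" "arr b" "src a = tgt f" "src b = \<I>" "tgt a = \<I>" "tgt b = \<I>" for a b
    by (rule assms(5)) (simp_all add: that)
qed (simp_all add: assms(1-4))

text \<open>No ancilla is required here: after composition with an effect on the output both sides
  are effects, and those are determined by their values on states.\<close>

lemma arrow_ext_states: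
  assumes "arr f" "arr g" "tgt f = tgt g" "src f = src g"
    and "\<And>\<rho>. arr \<rho> \<Longrightarrow> src \<rho> = \<I> \<Longrightarrow> tgt \<rho> = src f \<Longrightarrow> f \<cdot> \<rho> = g \<cdot> \<rho>"
  shows "f = g"
proof (rule arrow_ext_effects [OF assms(1-4)])
  fix a assume a: "arr a" "src a = tgt f" "tgt a = \<I>"
  have af: "arr (a \<cdot> f)" and ag: "arr (a \<cdot> g)"
    using assms(1-4) a by simp_all
  have "mor (a \<cdot> f) = mor (a \<cdot> g)"
  proof (rule effect_ext)
    show "mor (a \<cdot> f) \<in> Tr (src f) \<I>"
      using af unfolding arr_def by (simp add: a(3))
    show "mor (a \<cdot> g) \<in> Tr (src f) \<I>"
      using ag unfolding arr_def by (simp add: a(3) assms(4))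
    fix \<rho> assume "\<rho> \<in> Tr \<I> (src f)"
    then have \<rho>: "arr (Arrow \<I> \<rho> (src f))"
      by (simp add: arr_def)
    then have "(a \<cdot> f) \<cdot> Arrow \<I> \<rho> (src f) = (a \<cdot> g) \<cdot> Arrow \<I> \<rho> (src f)"
      using assms(1-4) assms(5) [of "Arrow \<I> \<rho> (src f)"] a by simp
    then show "o_seq T (mor (a \<cdot> f)) \<rho> = o_seq T (mor (a \<cdot> g)) \<rho>"
      by (metis arrow.sel(2) arrow_projections(3))
  qed
  then show "a \<cdot> f = a \<cdot> g"
    using assms(3,4) by (intro arrow.expand) simp
qed

text \<open>Naturality of the swap with respect to an effect on \<open>A\<close> reduces both claims
  to \<open>swp_unit_unit\<close>.\<close>

lemma swp_unit [simp]: "swp \<I> A = ident A" "swp A \<I> = ident A"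
proof -
  show "swp \<I> A = ident A"
  proof (rule arrow_ext_effects)
    fix a assume "arr a" "src a = tgt (swp \<I> A)" "tgt a = \<I>"
    then show "a \<cdot> swp \<I> A = a \<cdot> ident A"
      using swp_natural [of "ident \<I>" a \<I> \<I>] by simp
  qed simp_all
  show "swp A \<I> = ident A"
  proof (rule arrow_ext_effects)
    fix a assume "arr a" "src a = tgt (swp A \<I>)" "tgt a = \<I>"
    then show "a \<cdot> swp A \<I> = a \<cdot> ident A"
      using swp_natural [of a "ident \<I>" \<I> \<I>] by simp
  qed simp_all
qed

lemma discard_swp [simp]:
  "(ident B \<otimes> discard A) \<cdot> swp A B = discard A \<otimes> ident B"
  "(discard B \<otimes> ident A) \<cdot> swp A B = ident A \<otimes> discard B"
  using swp_natural [of "discard A" "ident B" \<I> B] swp_natural [of "ident A" "discard B" A \<I>] by simp_all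

lemma swp_state: "arr \<rho> \<Longrightarrow> arr \<sigma> \<Longrightarrow> src \<rho> = \<I> \<Longrightarrow> src \<sigma> = \<I> \<Longrightarrow>
    swp (tgt \<rho>) (tgt \<sigma>) \<cdot> (\<rho> \<otimes> \<sigma>) = \<sigma> \<otimes> \<rho>"
  using swp_natural [of \<rho> \<sigma> "tgt \<rho>" "tgt \<sigma>"] by simp

lemma discard_tens3_comp [simp]:
  "chan f \<Longrightarrow> tgt f = A \<odot> B \<odot> D \<Longrightarrow> (discard A \<otimes> discard B \<otimes> discard D) \<cdot> f = discard (src f)"
  using discard_comp [of f "A \<odot> B \<odot> D"] by simp

lemma tens3_comp:
  assumes "arr f" "arr g" "arr h" "arr \<psi>" "arr \<phi>" "tgt \<psi> = src f \<odot> src g" "tgt \<phi> = src h"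
  shows "(f \<otimes> g \<otimes> h) \<cdot> (\<psi> \<otimes> \<phi>) = ((f \<otimes> g) \<cdot> \<psi>) \<otimes> (h \<cdot> \<phi>)"
  using assms tens_comp [of \<psi> "f \<otimes> g" \<phi> h] by simp

subsection \<open>Pure states and purifications\<close>

definition rfn :: "('s, 't) arrow \<Rightarrow> ('s, 't) arrow \<Rightarrow> bool" where
  "rfn D \<tau> \<longleftrightarrow> src D = \<I> \<and> src \<tau> = \<I> \<and> tgt D = tgt \<tau> \<and> refines T \<I> (tgt \<tau>) (mor D) (mor \<tau>)"

text \<open>In contrast to \<open>pure_state\<close>, normalization is built in through
  \<open>chan\<close>.\<close>

definition pstate :: "('s, 't) arrow \<Rightarrow> bool" where
  "pstate \<psi> \<longleftrightarrow> chan \<psi> \<and> src \<psi> = \<I> \<and> atomic T \<I> (tgt \<psi>) (mor \<psi>)"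

definition rev :: "('s, 't) arrow \<Rightarrow> bool" where
  "rev U \<longleftrightarrow> chan U \<and> (\<exists>W. chan W \<and> src W = tgt U \<and> tgt W = src U \<and>
     W \<cdot> U = ident (src U) \<and> U \<cdot> W = ident (tgt U))"

definition purif :: "'s \<Rightarrow> 's \<Rightarrow> ('s, 't) arrow \<Rightarrow> ('s, 't) arrow \<Rightarrow> bool" where
  "purif A R \<rho> \<Psi> \<longleftrightarrow> pstate \<Psi> \<and> tgt \<Psi> = A \<odot> R \<and> (ident A \<otimes> discard R) \<cdot> \<Psi> = \<rho>"

lemma rfnD:
  assumes "rfn D \<tau>"
  shows "arr D" "src D = \<I>" "src \<tau> = \<I>" "tgt D = tgt \<tau>"
  using assms refines_Tr by (auto simp: rfn_def arr_def)

lemma rfn_self: "chan \<tau> \<Longrightarrow> src \<tau> = \<I> \<Longrightarrow> rfn \<tau> \<tau>"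
  by (simp add: rfn_def chan_def refines_self)

lemma rfn_chan: "rfn D \<tau> \<Longrightarrow> chan f \<Longrightarrow> src f = tgt \<tau> \<Longrightarrow> rfn (f \<cdot> D) (f \<cdot> \<tau>)"
  using refines_channel_seq [of \<I> "tgt \<tau>" "mor D" "mor \<tau>" "tgt f" "mor f"]
  by (simp add: rfn_def chan_def)

lemma rfn_effect:
  assumes "rfn D \<tau>" "tgt \<tau> = A \<odot> B" "arr b" "src b = B" "tgt b = \<I>"
  shows "rfn ((ident A \<otimes> b) \<cdot> D) ((ident A \<otimes> discard B) \<cdot> \<tau>)"
  using refines_marginal [of A B "mor D" "mor \<tau>" "mor b"] assms
  by (simp add: rfn_def arr_def marginal_def)

lemma pstateD: "pstate \<psi> \<Longrightarrow> chan \<psi>" "pstate \<psi> \<Longrightarrow> arr \<psi>" "pstate \<psi> \<Longrightarrow> src \<psi> = \<I>"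
  by (auto simp: pstate_def chan_arr)

lemma pstate_rfn:
  assumes "pstate \<psi>" "rfn D \<psi>"
  obtains l where "0 \<le> l" "l \<le> 1" "mor D = l *\<^sub>R mor \<psi>"
  using assms unfolding pstate_def rfn_def atomic_def by fastforce

lemma pstateI:
  assumes "chan \<psi>" "src \<psi> = \<I>"
    and "\<And>D. rfn D \<psi> \<Longrightarrow> \<exists>l\<in>{0..1}. mor D = l *\<^sub>R mor \<psi>"
  shows "pstate \<psi>"
  unfolding pstate_def atomic_def
proof (intro conjI allI impI assms(1,2))
  fix D assume "refines T \<I> (tgt \<psi>) D (mor \<psi>)"
  then have "rfn (Arrow \<I> D (tgt \<psi>)) \<psi>"
    using assms(2) by (simp add: rfn_def)
  from assms(3) [OF this] show "\<exists>l\<in>{0..1}. D = l *\<^sub>R mor \<psi>"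
    by simp
qed

text \<open>Conditioning \<open>D\<close> on any effect on \<open>B\<close> yields a refinement of
  the pure marginal, hence a multiple of \<open>\<psi>\<close>. So \<open>D\<close> agrees with a
  product on all product effects.\<close>

lemma rfn_pure_marginal:
  assumes D: "rfn D \<tau>" and \<tau>: "tgt \<tau> = A \<odot> B" "(ident A \<otimes> discard B) \<cdot> \<tau> = \<psi>" and \<psi>: "pstate \<psi>"
  shows "D = \<psi> \<otimes> ((discard A \<otimes> ident B) \<cdot> D)"
proof (rule state_arrow_ext [of _ _ A B])
  have tgt_\<psi>: "tgt \<psi> = A"
    using \<tau>(2) by force
  note [simp] = rfnD [OF D] \<tau>(1) pstateD [OF \<psi>] tgt_\<psi>
  fix a b assume [simp]: "arr a" "arr b" "src a = A" "src b = B" "tgt a = \<I>" "tgt b = \<I>"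
  define x where "x = (ident A \<otimes> b) \<cdot> D"
  have x [simp]: "arr x" "src x = \<I>" "tgt x = A"
    by (simp_all add: x_def)
  have "rfn x \<psi>"
    using rfn_effect [OF D \<tau>(1), of b] by (simp add: x_def \<tau>(2))
  then obtain l where l: "mor x = l *\<^sub>R mor \<psi>"
    by (rule pstate_rfn [OF \<psi>])
  have e\<psi>: "o_seq T (det_eff T A) (mor \<psi>) = o_id T \<I>"
    using pstateD(1) [OF \<psi>] by (simp add: chan_def channel_def det_eff_unit)
  \<comment> \<open>As \<open>\<psi>\<close> is normalized, the proportionality factor of
    \<open>x\<close> is recovered by discarding \<open>A\<close>.\<close>
  have "x = \<psi> \<cdot> (discard A \<cdot> x)"
    using pstateD(2) [OF \<psi>]
    by (intro arrow.expand) (simp add: l e\<psi> arr_def seq_id)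
  then have "(a \<otimes> b) \<cdot> D = (a \<cdot> \<psi>) \<cdot> (discard A \<cdot> x)"
    using tens_eq_comp_right [of a b] by (simp add: x_def)
  also have "\<dots> = (a \<cdot> \<psi>) \<cdot> ((discard A \<otimes> b) \<cdot> D)"
    using tens_eq_comp_right [of "discard A" b] by (simp add: x_def)
  also have "\<dots> = (a \<cdot> \<psi>) \<otimes> ((discard A \<otimes> b) \<cdot> D)"
    using tens_eq_comp_right [of "a \<cdot> \<psi>" "(discard A \<otimes> b) \<cdot> D"] by simp
  also have "(discard A \<otimes> b) \<cdot> D = b \<cdot> ((discard A \<otimes> ident B) \<cdot> D)"
    using tens_eq_comp_left [of b "discard A"] by simp
  also have "(a \<cdot> \<psi>) \<otimes> (b \<cdot> ((discard A \<otimes> ident B) \<cdot> D)) = (a \<otimes> b) \<cdot> (\<psi> \<otimes> ((discard A \<otimes> ident B) \<cdot> D))"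
    by simp
  finally show "(a \<otimes> b) \<cdot> D = (a \<otimes> b) \<cdot> (\<psi> \<otimes> ((discard A \<otimes> ident B) \<cdot> D))" .
qed (use rfnD [OF D] \<tau> pstateD [OF \<psi>] in auto)

text \<open>A refinement of the product has the form \<open>\<psi> \<otimes> D'\<close> by
  \<open>rfn_pure_marginal\<close>, and \<open>D'\<close> refines \<open>\<phi>\<close>, so purity
  of \<open>\<phi>\<close> finishes the argument.\<close>

lemma pstate_tens:
  assumes "pstate \<psi>" "pstate \<phi>"
  shows "pstate (\<psi> \<otimes> \<phi>)"
proof (rule pstateI)
  note [simp] = pstateD [OF assms(1)] pstateD [OF assms(2)]
  fix D assume D: "rfn D (\<psi> \<otimes> \<phi>)"
  have eq: "D = \<psi> \<otimes> ((discard (tgt \<psi>) \<otimes> ident (tgt \<phi>)) \<cdot> D)"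
    by (rule rfn_pure_marginal [OF D]) (simp_all add: assms)
  have "rfn ((discard (tgt \<psi>) \<otimes> ident (tgt \<phi>)) \<cdot> D) \<phi>"
    using rfn_chan [OF D, of "discard (tgt \<psi>) \<otimes> ident (tgt \<phi>)"] by simp
  then obtain l where "0 \<le> l" "l \<le> 1"
    and "mor ((discard (tgt \<psi>) \<otimes> ident (tgt \<phi>)) \<cdot> D) = l *\<^sub>R mor \<phi>"
    by (rule pstate_rfn [OF assms(2)])
  then show "\<exists>l\<in>{0..1}. mor D = l *\<^sub>R mor (\<psi> \<otimes> \<phi>)"
    by (subst eq, intro bexI [of _ l]) auto
qed (simp_all add: pstateD [OF assms(1)] pstateD [OF assms(2)])

lemma rev_chan: "rev U \<Longrightarrow> chan U"
  by (simp add: rev_def)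

text \<open>Refinements of the image are pulled back along the inverse channel to refinements of
  \<open>\<psi>\<close>.\<close>

lemma pstate_rev:
  assumes "pstate \<psi>" "rev U" "src U = tgt \<psi>"
  shows "pstate (U \<cdot> \<psi>)"
proof (rule pstateI)
  note [simp] = pstateD [OF assms(1)] rev_chan [OF assms(2)] chan_arr
  fix D assume D: "rfn D (U \<cdot> \<psi>)"
  note [simp] = rfnD [OF D] assms(3)
  obtain W where W [simp]: "chan W" "src W = tgt U" "tgt W = src U"
    and WU: "W \<cdot> U = ident (src U)" and UW: "U \<cdot> W = ident (tgt U)"
    using assms(2) by (auto simp: rev_def)
  have "W \<cdot> U \<cdot> \<psi> = (W \<cdot> U) \<cdot> \<psi>"
    by simp
  then have "W \<cdot> U \<cdot> \<psi> = \<psi>"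
    by (simp add: WU del: comp_assoc)
  then have "rfn (W \<cdot> D) \<psi>"
    using rfn_chan [OF D, of W] by simp
  then obtain l where "0 \<le> l" "l \<le> 1" and l: "mor (W \<cdot> D) = l *\<^sub>R mor \<psi>"
    by (rule pstate_rfn [OF assms(1)])
  have "D = (U \<cdot> W) \<cdot> D"
    by (simp add: UW del: comp_assoc)
  also have "\<dots> = U \<cdot> (W \<cdot> D)"
    by simp
  finally have "mor D = o_seq T (mor U) (mor (W \<cdot> D))"
    by (metis arrow_projections(3))
  then show "\<exists>l\<in>{0..1}. mor D = l *\<^sub>R mor (U \<cdot> \<psi>)"
    using \<open>0 \<le> l\<close> \<open>l \<le> 1\<close> unfolding l by (intro bexI [of _ l]) auto
qed (use assms(3) pstateD [OF assms(1)] rev_chan [OF assms(2)] in auto)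

lemma rev_ident [simp]: "rev (ident A)"
  unfolding rev_def by (intro conjI exI [of _ "ident A"]) simp_all

lemma rev_swp [simp]: "rev (swp A B)"
  unfolding rev_def by (intro conjI exI [of _ "swp B A"]) simp_all

lemma rev_comp:
  assumes "rev U" "rev V" "tgt U = src V"
  shows "rev (V \<cdot> U)"
proof -
  obtain U' V' where [simp]: "chan U'" "src U' = tgt U" "tgt U' = src U"
      "chan V'" "src V' = tgt V" "tgt V' = src V"
    and inv: "U' \<cdot> U = ident (src U)" "U \<cdot> U' = ident (tgt U)"
      "V' \<cdot> V = ident (src V)" "V \<cdot> V' = ident (tgt V)"
    using assms(1,2) unfolding rev_def by blast
  note [simp] = rev_chan [OF assms(1)] rev_chan [OF assms(2)] assms(3) chan_arr
  have "(U' \<cdot> V') \<cdot> (V \<cdot> U) = U' \<cdot> ((V' \<cdot> V) \<cdot> U)" "(V \<cdot> U) \<cdot> (U' \<cdot> V') = V \<cdot> ((U \<cdot> U') \<cdot> V')"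
    by simp_all
  then have "(U' \<cdot> V') \<cdot> (V \<cdot> U) = ident (src U)" "(V \<cdot> U) \<cdot> (U' \<cdot> V') = ident (tgt V)"
    by (simp_all add: inv del: comp_assoc)
  then show ?thesis
    unfolding rev_def by (intro conjI exI [of _ "U' \<cdot> V'"]) (simp_all del: comp_assoc)
qed

lemma rev_tens:
  assumes "rev U" "rev V"
  shows "rev (U \<otimes> V)"
proof -
  obtain U' V' where "chan U'" "src U' = tgt U" "tgt U' = src U"
      "chan V'" "src V' = tgt V" "tgt V' = src V"
    and "U' \<cdot> U = ident (src U)" "U \<cdot> U' = ident (tgt U)"
      "V' \<cdot> V = ident (src V)" "V \<cdot> V' = ident (tgt V)"
    using assms unfolding rev_def by blast
  then show ?thesis
    unfolding rev_def using rev_chan [OF assms(1)] rev_chan [OF assms(2)]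
    by (intro conjI exI [of _ "U' \<otimes> V'"]) (simp_all add: chan_arr)
qed

lemma purifD:
  assumes "purif A R \<rho> \<Psi>"
  shows "pstate \<Psi>" "chan \<Psi>" "arr \<Psi>" "src \<Psi> = \<I>" "tgt \<Psi> = A \<odot> R" "(ident A \<otimes> discard R) \<cdot> \<Psi> = \<rho>"
  using assms by (auto simp: purif_def pstateD)

lemma purif_marginal:
  assumes "purif A R \<rho> \<Psi>"
  shows "chan \<rho>" "arr \<rho>" "src \<rho> = \<I>" "tgt \<rho> = A"
  unfolding purifD(6) [OF assms, symmetric] by (simp_all add: purifD(1-5) [OF assms])

lemma purif_swap:
  assumes "pstate \<Psi>" "tgt \<Psi> = A \<odot> R"
  shows "purif R A ((discard A \<otimes> ident R) \<cdot> \<Psi>) (swp A R \<cdot> \<Psi>)"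
  unfolding purif_def using assms pstateD [OF assms(1)]
  by (simp add: pstate_rev flip: comp_assoc)

lemma purification_iff:
  "purification T A R \<rho> \<Psi> \<longleftrightarrow> purif A R (Arrow \<I> \<rho> A) (Arrow \<I> \<Psi> (A \<odot> R))"
  by (auto simp: purification_def purif_def pstate_def chan_def norm_states_iff_channel
      pure_state_def states_def marginal_def comp_def channel_def)

lemma reversible_iff: "reversible T A B U \<longleftrightarrow> rev (Arrow A U B)"
proof
  assume "reversible T A B U"
  then obtain W where "channel T A B U" "channel T B A W"
    "o_seq T W U = o_id T A" "o_seq T U W = o_id T B"
    by (auto simp: reversible_def)
  then show "rev (Arrow A U B)"
    by (auto simp: rev_def chan_def comp_def ident_def intro!: exI [of _ "Arrow B W A"])
next
  assume "rev (Arrow A U B)"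
  then obtain W where "chan (Arrow A U B)" "chan W" "src W = B" "tgt W = A"
    "W \<cdot> Arrow A U B = ident A" "Arrow A U B \<cdot> W = ident B"
    by (auto simp: rev_def)
  then show "reversible T A B U"
    by (auto simp: reversible_def chan_def comp_def ident_def intro!: exI [of _ "mor W"])
qed

end

section \<open>Uniqueness of purification and steering\<close>

locale purification_theory = opt_theory +
  assumes postulate: "purification_postulate T"
begin

lemma ex_purif:
  assumes "chan \<rho>" "src \<rho> = \<I>"
  obtains R \<Psi> where "purif (tgt \<rho>) R \<rho> \<Psi>"
proof -
  have "mor \<rho> \<in> norm_states T (tgt \<rho>)"
    using assms by (simp add: norm_states_iff_channel chan_def)
  then obtain R \<Psi> where "purification T (tgt \<rho>) R (mor \<rho>) \<Psi>"
    using postulate unfolding purification_postulate_def by blast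
  then show ?thesis
    using that assms(2) unfolding purification_iff by (metis arrow.collapse)
qed

lemma purif_unique:
  assumes "purif A R \<rho> \<Psi>" "purif A R \<rho> \<Psi>'"
  obtains U where "rev U" "src U = R" "tgt U = R" "\<Psi>' = (ident A \<otimes> U) \<cdot> \<Psi>"
proof -
  have "\<rho> = Arrow \<I> (mor \<rho>) A"
    using purifD [OF assms(1)] by (metis arrow.collapse arrow_projections(1,2,5,8,14) sys_unit)
  moreover have "\<Psi> = Arrow \<I> (mor \<Psi>) (A \<odot> R)" "\<Psi>' = Arrow \<I> (mor \<Psi>') (A \<odot> R)"
    using purifD [OF assms(1)] purifD [OF assms(2)] by (metis arrow.collapse)+
  ultimately have "purification T A R (mor \<rho>) (mor \<Psi>)" "purification T A R (mor \<rho>) (mor \<Psi>')"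
    using assms unfolding purification_iff by simp_all
  then obtain U where U: "reversible T R R U" "mor \<Psi>' = o_seq T (o_ten T (o_id T A) U) (mor \<Psi>)"
    using postulate unfolding purification_postulate_def by blast
  show ?thesis
  proof (rule that [of "Arrow R U R"])
    show "rev (Arrow R U R)"
      using U(1) by (simp add: reversible_iff)
    show "\<Psi>' = (ident A \<otimes> Arrow R U R) \<cdot> \<Psi>"
      using U(2) purifD [OF assms(1)] purifD [OF assms(2)] by (intro arrow.expand) simp
  qed simp_all
qed

text \<open>Purifications with different purifying systems are compared by tensoring each with the
  other one, which makes the purifying systems equal without choosing any further pure state.\<close>

lemma purif_link:
  assumes "purif X P \<tau> \<Psi>" "purif X Q \<tau> \<Psi>'"
  obtains U \<phi> where "rev U" "src U = P \<odot> Q \<odot> X" "tgt U = Q \<odot> X \<odot> P"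
    "pstate \<phi>" "tgt \<phi> = Q \<odot> X" "(ident X \<otimes> U) \<cdot> (\<Psi> \<otimes> \<phi>) = \<Psi>' \<otimes> \<Psi>"
proof -
  note [simp] = purifD [OF assms(1)] purifD(1-5) [OF assms(2)] chan_arr
  have marg [simp]: "(ident X \<otimes> discard Q) \<cdot> \<Psi>' = \<tau>"
    by (rule purifD [OF assms(2)])
  \<comment> \<open>With the factors of \<open>\<Psi>'\<close> exchanged,
    \<open>\<Psi> \<otimes> \<phi>\<close> lives on \<open>X \<odot> P \<odot> Q \<odot> X\<close>.
    This is the order that \<open>\<Psi>' \<otimes> \<Psi>\<close> acquires once
    \<open>Q \<odot> X\<close> and \<open>P\<close> are swapped, so both states have the same
    purifying system.\<close>
  define \<phi> where "\<phi> = swp X Q \<cdot> \<Psi>'"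
  have \<phi>: "pstate \<phi>" "tgt \<phi> = Q \<odot> X"
    by (simp_all add: \<phi>_def pstate_rev)
  note [simp] = \<phi> pstateD [OF \<phi>(1)]
  have \<tau> [simp]: "arr \<tau>"
    by (rule purif_marginal [OF assms(1)])
  have 1: "purif X (P \<odot> Q \<odot> X) \<tau> (\<Psi> \<otimes> \<phi>)"
    unfolding purif_def by (simp add: pstate_tens tens3_comp)
  have 2: "purif X (P \<odot> Q \<odot> X) \<tau> ((ident X \<otimes> swp (Q \<odot> X) P) \<cdot> (\<Psi>' \<otimes> \<Psi>))"
    unfolding purif_def by (simp add: pstate_rev pstate_tens rev_tens tens3_comp)
  obtain U0 where U0: "rev U0" "src U0 = P \<odot> Q \<odot> X" "tgt U0 = P \<odot> Q \<odot> X"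
    and eq: "(ident X \<otimes> swp (Q \<odot> X) P) \<cdot> (\<Psi>' \<otimes> \<Psi>) = (ident X \<otimes> U0) \<cdot> (\<Psi> \<otimes> \<phi>)"
    by (rule purif_unique [OF 1 2])
  note [simp] = U0 rev_chan [OF U0(1)]
  let ?U = "swp P (Q \<odot> X) \<cdot> U0"
  have "(ident X \<otimes> ?U) \<cdot> (\<Psi> \<otimes> \<phi>) = (ident X \<otimes> swp P (Q \<odot> X)) \<cdot> (ident X \<otimes> U0) \<cdot> (\<Psi> \<otimes> \<phi>)"
    by simp
  also have "\<dots> = \<Psi>' \<otimes> \<Psi>"
    unfolding eq [symmetric] by (simp add: tens3_comp)
  finally show ?thesis
    using that [of ?U \<phi>] by (simp add: rev_comp)
qed

text \<open>The channel appends the pure state \<open>\<phi>\<close> of \<open>purif_link\<close>,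
  applies the reversible \<open>U\<close>, and discards everything except \<open>Q\<close>.\<close>

lemma purif_channel:
  assumes "purif X P \<tau> \<Psi>" "purif X Q \<tau> \<Psi>'"
  obtains K where "chan K" "src K = P" "tgt K = Q" "(ident X \<otimes> K) \<cdot> \<Psi> = \<Psi>'"
proof -
  obtain U \<phi> where U: "rev U" "src U = P \<odot> Q \<odot> X" "tgt U = Q \<odot> X \<odot> P"
    "pstate \<phi>" "tgt \<phi> = Q \<odot> X" "(ident X \<otimes> U) \<cdot> (\<Psi> \<otimes> \<phi>) = \<Psi>' \<otimes> \<Psi>"
    by (rule purif_link [OF assms])
  note [simp] = purifD [OF assms(1)] purifD(1-5) [OF assms(2)] chan_arr U(1-5) rev_chan [OF U(1)]
    pstateD [OF U(4)]
  let ?K = "(ident Q \<otimes> discard X \<otimes> discard P) \<cdot> U \<cdot> (ident P \<otimes> \<phi>)"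
  have "(ident X \<otimes> ?K) \<cdot> \<Psi> = (ident X \<otimes> ident Q \<otimes> discard X \<otimes> discard P) \<cdot>
      (ident X \<otimes> U) \<cdot> (ident X \<otimes> ident P \<otimes> \<phi>) \<cdot> \<Psi>"
    by simp
  also have "(ident X \<otimes> ident P \<otimes> \<phi>) \<cdot> \<Psi> = \<Psi> \<otimes> \<phi>"
    using tens_state_right [of \<Psi> \<phi>] by simp
  also have "(ident X \<otimes> ident Q \<otimes> discard X \<otimes> discard P) \<cdot> (ident X \<otimes> U) \<cdot> (\<Psi> \<otimes> \<phi>) = \<Psi>'"
    unfolding U(6) by (simp add: tens3_comp)
  finally show ?thesis
    using that [of ?K] by simp
qed

text \<open>The refinement \<open>D\<close> and its complement in \<open>\<rho>\<close> are tagged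
  with perfectly distinguishable flags on an extra system \<open>X\<close>. A purification of the
  tagged state also purifies \<open>\<rho>\<close>, so a channel on \<open>R\<close> turns
  \<open>\<Psi>\<close> into it; reading the flag after that channel is the required effect.\<close>

lemma steering:
  assumes "purif A R \<rho> \<Psi>" "rfn D \<rho>"
  obtains b where "arr b" "src b = R" "tgt b = \<I>" "D = (ident A \<otimes> b) \<cdot> \<Psi>"
proof -
  note \<Psi> [simp] = purifD [OF assms(1)]
  note D [simp] = rfnD [OF assms(2)]
  have \<rho> [simp]: "chan \<rho>" "tgt \<rho> = A"
    by (rule purif_marginal [OF assms(1)])+
  obtain D' D'' where t: "[mor D, D', D''] \<in> Tests \<I> A" "mor \<rho> = mor D + D'"
    using assms(2) by (auto simp: rfn_def refines_iff)
  have mem: "D' \<in> Tr \<I> A" "D'' \<in> Tr \<I> A"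
    using test_Tr [OF t(1)] by auto
  have "channel T \<I> A (mor D + D' + D'')"
    using total_test [OF t(1)] by (simp add: channel_iff_test add.assoc)
  moreover have "channel T \<I> A (mor D + D')"
    using \<rho> D(3) unfolding chan_def t(2) by simp
  ultimately have "o_seq T (det_eff T A) D'' = 0"
    by (simp add: channel_def)
  \<comment> \<open>Both \<open>\<rho>\<close> and the total of the test are normalized, so the
    outcome outside \<open>\<rho>\<close> has probability zero.\<close>
  then have "D'' = 0"
    by (rule state_zero [OF mem(2)])
  have "map (\<lambda>k. \<Sum>i\<in>{i. i < length [mor D, D', D''] \<and> min i 1 = k}. [mor D, D', D''] ! i) [0..<2] \<in> Tests \<I> A"
    by (rule coarse_graining [OF t(1)]) simp
  moreover have "{i. i < 3 \<and> min i 1 = 0} = {0::nat}" "{i. i < 3 \<and> min i 1 = 1} = {1, 2::nat}"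
    by auto
  ultimately have test: "[mor D, D'] \<in> Tests \<I> A"
    using \<open>D'' = 0\<close> by (simp add: upt_rec numeral_eq_Suc)
  obtain X \<phi>1 \<phi>2 a1 where \<phi>: "channel T \<I> X \<phi>1" "channel T \<I> X \<phi>2" and a: "a1 \<in> Tr X \<I>"
    "o_seq T a1 \<phi>1 = o_id T \<I>" "o_seq T a1 \<phi>2 = 0"
    by (rule ex_distinguishable)
  define F1 F2 G a where "F1 = Arrow \<I> \<phi>1 X" "F2 = Arrow \<I> \<phi>2 X" "G = Arrow \<I> D' A" "a = Arrow X a1 \<I>"
  have [simp]: "chan F1" "chan F2" "src F1 = \<I>" "src F2 = \<I>" "tgt F1 = X" "tgt F2 = X"
    "arr G" "src G = \<I>" "tgt G = A" "mor G = D'" "arr a" "src a = X" "tgt a = \<I>"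
    using \<phi> a mem by (simp_all add: F1_F2_G_a_def chan_def arr_def)
  note [simp] = chan_arr
  \<comment> \<open>The tagged state: flag \<open>F1\<close> accompanies \<open>D\<close>, flag
    \<open>F2\<close> accompanies the remainder \<open>G\<close>. Conditioning shows below that it
    is a normalized state.\<close>
  define \<theta> where "\<theta> = Arrow \<I> (mor ((ident A \<otimes> F1) \<cdot> D) + mor ((ident A \<otimes> F2) \<cdot> G)) (A \<odot> X)"
  have [simp]: "src \<theta> = \<I>" "tgt \<theta> = A \<odot> X"
    by (simp_all add: \<theta>_def)
  let ?us = "\<lambda>i. if i = 0 then [o_ten T (o_id T A) \<phi>1] else [o_ten T (o_id T A) \<phi>2]"
  have us: "?us i \<in> Tests A (A \<odot> X)" for i :: nat
    using channel_ten [OF channel_id \<phi>(1), of A] channel_ten [OF channel_id \<phi>(2), of A]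
    by (simp add: channel_iff_test)
  have "concat (map (\<lambda>i. map (\<lambda>u. o_seq T u ([mor D, D'] ! i)) (?us i)) [0..<length [mor D, D']]) \<in> Tests \<I> (A \<odot> X)"
    by (rule conditioning [OF test us])
  from total_test [OF this] have \<theta>_chan [simp]: "chan \<theta>"
    by (simp add: \<theta>_def F1_F2_G_a_def chan_def channel_iff_test)
  have "(ident A \<otimes> discard X) \<cdot> (ident A \<otimes> F1) \<cdot> D = D" "(ident A \<otimes> discard X) \<cdot> (ident A \<otimes> F2) \<cdot> G = G"
    by simp_all
  note this [THEN arg_cong [where f = mor], unfolded arrow_projections]
  then have marg: "(ident A \<otimes> discard X) \<cdot> \<theta> = \<rho>"
    by (intro arrow.expand) (simp add: \<theta>_def t(2))
  have "a \<cdot> F1 = ident \<I>"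
    using a by (intro arrow.expand) (simp add: F1_F2_G_a_def)
  then have "(ident A \<otimes> a) \<cdot> (ident A \<otimes> F1) \<cdot> D = D"
    by simp
  moreover have "mor ((ident A \<otimes> a) \<cdot> (ident A \<otimes> F2) \<cdot> G) = 0"
    by (subst tens_comp_comp) (simp_all, simp add: F1_F2_G_a_def a)
  ultimately have "mor ((ident A \<otimes> a) \<cdot> (ident A \<otimes> F1) \<cdot> D) + mor ((ident A \<otimes> a) \<cdot> (ident A \<otimes> F2) \<cdot> G) = mor D"
    by (simp only: add_0_right)
  note this [unfolded arrow_projections]
  then have D_eq: "(ident A \<otimes> a) \<cdot> \<theta> = D"
    by (intro arrow.expand) (simp add: \<theta>_def)
  obtain Y \<Theta> where \<Theta>: "purif (A \<odot> X) Y \<theta> \<Theta>"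
    using ex_purif [of \<theta>] by auto
  note [simp] = purifD(1-5) [OF \<Theta>]
  have \<Theta>_marg: "(ident A \<otimes> ident X \<otimes> discard Y) \<cdot> \<Theta> = \<theta>"
    using purifD(6) [OF \<Theta>] by simp
  have "(ident A \<otimes> discard X \<otimes> discard Y) \<cdot> \<Theta>
      = (ident A \<otimes> discard X) \<cdot> (ident A \<otimes> ident X \<otimes> discard Y) \<cdot> \<Theta>"
    by simp
  then have "purif A (X \<odot> Y) \<rho> \<Theta>"
    by (simp add: purif_def \<Theta>_marg marg)
  \<comment> \<open>With \<open>X \<odot> Y\<close> as purifying system, \<open>\<Theta>\<close>
    purifies \<open>\<rho>\<close> and is comparable with \<open>\<Psi>\<close>.\<close>
  then obtain K where K [simp]: "chan K" "src K = R" "tgt K = X \<odot> Y" and K_eq: "(ident A \<otimes> K) \<cdot> \<Psi> = \<Theta>"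
    by (rule purif_channel [OF assms(1)])
  have "(ident A \<otimes> ((a \<otimes> discard Y) \<cdot> K)) \<cdot> \<Psi> = (ident A \<otimes> a \<otimes> discard Y) \<cdot> (ident A \<otimes> K) \<cdot> \<Psi>"
    by simp
  also have "\<dots> = (ident A \<otimes> a) \<cdot> (ident A \<otimes> ident X \<otimes> discard Y) \<cdot> \<Theta>"
    unfolding K_eq using tens_eq_comp_right [of a "discard Y"] by simp
  also have "\<dots> = D"
    by (simp only: \<Theta>_marg D_eq)
  finally show ?thesis
    using that [of "(a \<otimes> discard Y) \<cdot> K"] by simp
qed

subsection \<open>Faithful states and dilations\<close>

text \<open>Non-determinism supplies a probability other than \<open>0\<close> and \<open>1\<close>;
  the complementary outcome is forced, since scalars of a test sum to the identity.\<close>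

lemma ex_nontrivial_coin:
  obtains p where "0 < p" "p < 1" "[p *\<^sub>R o_id T \<I>, (1 - p) *\<^sub>R o_id T \<I>] \<in> Tests \<I> \<I>"
proof -
  obtain A a \<rho> where a: "a \<in> Tr A \<I>" "\<rho> \<in> Tr \<I> A" "prob T a \<rho> \<noteq> 0" "prob T a \<rho> \<noteq> 1"
    using not_deterministic by (auto simp: effects_def states_def)
  define p where "p = prob T a \<rho>"
  have p: "0 < p" "p < 1"
    using a prob_nonneg [OF a(1,2)] prob_le_1 [OF a(1,2)] by (auto simp: p_def)
  have "p *\<^sub>R o_id T \<I> \<in> Tr \<I> \<I>"
    using seq_Tr [OF a(2,1)] seq_effect_state [OF a(1,2)] by (simp add: p_def)
  then obtain f' where f': "[p *\<^sub>R o_id T \<I>, f'] \<in> Tests \<I> \<I>"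
    using ex_two_outcome_test by blast
  have "f' = (1 - p) *\<^sub>R o_id T \<I>"
    using scalar_test [OF f'] by (simp add: algebra_simps)
  then show ?thesis
    using that p f' by blast
qed

text \<open>The coin is tossed first and decides which of the two preparation tests follows.\<close>

lemma mixture_test:
  assumes "[p *\<^sub>R o_id T \<I>, q *\<^sub>R o_id T \<I>] \<in> Tests \<I> \<I>" "ts \<in> Tests \<I> A" "us \<in> Tests \<I> A"
  shows "map ((*\<^sub>R) p) ts @ map ((*\<^sub>R) q) us \<in> Tests \<I> A"
proof -
  have id: "o_seq T t (o_id T \<I>) = t" if "t \<in> set ts \<union> set us" for t
    using that assms(2,3) [THEN test_Tr] seq_id by blast
  have "concat (map (\<lambda>i. map (\<lambda>u. o_seq T u ([p *\<^sub>R o_id T \<I>, q *\<^sub>R o_id T \<I>] ! i)) (if i = 0 then ts else us))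
      [0..<length [p *\<^sub>R o_id T \<I>, q *\<^sub>R o_id T \<I>]]) \<in> Tests \<I> A"
    by (rule conditioning [OF assms(1)]) (simp add: assms(2,3))
  then show ?thesis
    using id by (simp cong: map_cong)
qed

text \<open>Induction on \<open>F\<close>, starting from the given state: the state found so far is
  mixed with the total of a test containing the new element. Old refinements survive with their
  weight multiplied by \<open>p\<close>.\<close>

lemma ex_internal_state:
  assumes "channel T \<I> A \<rho>" "finite F" "F \<subseteq> Tr \<I> A"
  shows "\<exists>\<omega>. channel T \<I> A \<omega> \<and> (\<forall>\<tau>\<in>F. \<exists>l>0. refines T \<I> A (l *\<^sub>R \<tau>) \<omega>)"
  using assms(2,3)
proof (induction F rule: finite_induct)
  case empty
  then show ?case
    using assms(1) by blast
next
  case (insert \<tau> F)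
  then obtain \<omega> where \<omega>: "channel T \<I> A \<omega>" "\<And>\<sigma>. \<sigma> \<in> F \<Longrightarrow> \<exists>l>0. refines T \<I> A (l *\<^sub>R \<sigma>) \<omega>"
    by auto
  obtain p where p: "0 < p" "p < 1" and coin: "[p *\<^sub>R o_id T \<I>, (1 - p) *\<^sub>R o_id T \<I>] \<in> Tests \<I> \<I>"
    by (rule ex_nontrivial_coin)
  obtain \<tau>' where \<tau>': "[\<tau>, \<tau>'] \<in> Tests \<I> A"
    using ex_two_outcome_test insert.prems by blast
  define \<xi> where "\<xi> = p *\<^sub>R \<omega> + (1 - p) *\<^sub>R (\<tau> + \<tau>')"
  have test: "[p *\<^sub>R \<omega>, (1 - p) *\<^sub>R \<tau>, (1 - p) *\<^sub>R \<tau>'] \<in> Tests \<I> A"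
    using mixture_test [OF coin _ \<tau>', of "[\<omega>]"] \<omega>(1) by (simp add: channel_iff_test)
  have "channel T \<I> A \<xi>"
    using total_test [OF test] by (simp add: channel_iff_test \<xi>_def scaleR_add_right)
  moreover have "refines T \<I> A ((1 - p) *\<^sub>R \<tau>) \<xi>"
    unfolding refines_def \<xi>_def using test
    by (intro exI [of _ "[p *\<^sub>R \<omega>, (1 - p) *\<^sub>R \<tau>, (1 - p) *\<^sub>R \<tau>']"] exI [of _ "{0, 1, 2}"])
       (auto simp: scaleR_add_right)
  moreover have "\<exists>l>0. refines T \<I> A (l *\<^sub>R \<sigma>) \<xi>" if \<sigma>: "\<sigma> \<in> F" for \<sigma>
  proof -
    obtain l where l: "l > 0" "refines T \<I> A (l *\<^sub>R \<sigma>) \<omega>"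
      using \<omega>(2) [OF \<sigma>] by blast
    then obtain D' D'' where D: "[l *\<^sub>R \<sigma>, D', D''] \<in> Tests \<I> A" "\<omega> = l *\<^sub>R \<sigma> + D'"
      unfolding refines_iff by blast
    let ?ts = "[p *\<^sub>R l *\<^sub>R \<sigma>, p *\<^sub>R D', p *\<^sub>R D'', (1 - p) *\<^sub>R \<tau>, (1 - p) *\<^sub>R \<tau>']"
    have "?ts \<in> Tests \<I> A"
      using mixture_test [OF coin D(1) \<tau>'] by simp
    \<comment> \<open>Index \<open>2\<close> is left out because \<open>D''\<close> lies outside
      \<open>\<omega>\<close>.\<close>
    moreover have "\<xi> = (\<Sum>j\<in>{0, 1, 3, 4}. ?ts ! j)"
      by (simp add: \<xi>_def D(2) algebra_simps)
    moreover have "(p * l) *\<^sub>R \<sigma> = ?ts ! 0" "{0, 1, 3, 4} \<subseteq> {..<length ?ts}"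
      by simp_all
    ultimately have "refines T \<I> A ((p * l) *\<^sub>R \<sigma>) \<xi>"
      unfolding refines_def by blast
    then show ?thesis
      using p(1) l(1) by (intro exI [of _ "p * l"]) simp
  qed
  ultimately show ?case
    using p by (intro exI [of _ \<xi>]) (auto intro: exI [of _ "1 - p"])
qed

text \<open>A purification of a state in which a spanning set of states occurs up to positive
  factors. By \<open>steering\<close>, transformations that agree on it agree on every refinement of
  \<open>\<omega>\<close>, hence on the spanning set, hence on all states by linearity.\<close>

lemma ex_faithful_state:
  assumes \<rho>: "chan \<rho>" "src \<rho> = \<I>" "tgt \<rho> = A"
  obtains R \<tau> \<Psi> where "purif R A \<tau> \<Psi>"
    and "\<And>f g. arr f \<Longrightarrow> arr g \<Longrightarrow> src f = A \<Longrightarrow> src g = A \<Longrightarrow> tgt f = tgt g \<Longrightarrow>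
      (ident R \<otimes> f) \<cdot> \<Psi> = (ident R \<otimes> g) \<cdot> \<Psi> \<Longrightarrow> f = g"
proof -
  \<comment> \<open>A basis consisting of states; it is finite because the states lie in a
    finite-dimensional span.\<close>
  obtain F where F: "F \<subseteq> Tr \<I> A" "independent F" "Tr \<I> A \<subseteq> span F"
    using maximal_independent_subset [of "Tr \<I> A"] by blast
  have "finite F"
    using states_finite_dim [of A] F(1,2) independent_span_bound [of _ F] by (auto simp: states_def)
  have "channel T \<I> A (mor \<rho>)"
    using \<rho> by (auto simp: chan_def)
  from ex_internal_state [OF this \<open>finite F\<close> F(1)]
  obtain w where w: "channel T \<I> A w" "\<And>\<tau>. \<tau> \<in> F \<Longrightarrow> \<exists>l>0. refines T \<I> A (l *\<^sub>R \<tau>) w"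
    by blast
  define \<omega> where "\<omega> = Arrow \<I> w A"
  obtain R \<Phi> where \<Phi>: "purif A R \<omega> \<Phi>"
    using ex_purif [of \<omega>] w(1) by (auto simp: \<omega>_def chan_def)
  note [simp] = purifD [OF \<Phi>]
  show ?thesis
  proof (rule that)
    show "purif R A ((discard A \<otimes> ident R) \<cdot> \<Phi>) (swp A R \<cdot> \<Phi>)"
      by (rule purif_swap) simp_all
    fix f g assume fg [simp]: "arr f" "arr g" "src f = A" "src g = A" "tgt f = tgt g"
      and eq: "(ident R \<otimes> f) \<cdot> swp A R \<cdot> \<Phi> = (ident R \<otimes> g) \<cdot> swp A R \<cdot> \<Phi>"
    \<comment> \<open>The faithful state carries \<open>A\<close> on the right while
      \<open>steering\<close> conditions with \<open>A\<close> on the left; naturality of the swap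
      translates between the two orders.\<close>
    have swap: "(h \<otimes> ident R) \<cdot> \<Phi> = swp R (tgt h) \<cdot> (ident R \<otimes> h) \<cdot> swp A R \<cdot> \<Phi>"
      if [simp]: "arr h" "src h = A" for h
    proof -
      have "(ident R \<otimes> h) \<cdot> swp A R = swp (tgt h) R \<cdot> (h \<otimes> ident R)"
        using swp_natural [of h "ident R" "tgt h" R] by simp
      then have "(ident R \<otimes> h) \<cdot> swp A R \<cdot> \<Phi> = swp (tgt h) R \<cdot> (h \<otimes> ident R) \<cdot> \<Phi>"
        by (simp flip: comp_assoc)
      then show ?thesis
        by simp
    qed
    have *: "(f \<otimes> ident R) \<cdot> \<Phi> = (g \<otimes> ident R) \<cdot> \<Phi>"
      using swap [of f] swap [of g] eq by simp
    have agree: "f \<cdot> D = g \<cdot> D" if "rfn D \<omega>" for D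
    proof -
      obtain b where [simp]: "arr b" "src b = R" "tgt b = \<I>" and D: "D = (ident A \<otimes> b) \<cdot> \<Phi>"
        by (rule steering [OF \<Phi> \<open>rfn D \<omega>\<close>])
      have "h \<cdot> D = (ident (tgt h) \<otimes> b) \<cdot> (h \<otimes> ident R) \<cdot> \<Phi>" if [simp]: "arr h" "src h = A" for h
        using tens_eq_comp_right [of h b] by (simp add: D)
      from this [of f] this [of g] show ?thesis
        using * by simp
    qed
    have basis: "o_seq T (mor f) x = o_seq T (mor g) x" if "x \<in> F" for x
    proof -
      obtain l where "l > 0" "refines T \<I> A (l *\<^sub>R x) w"
        using w(2) [OF \<open>x \<in> F\<close>] by blast
      then have "rfn (Arrow \<I> (l *\<^sub>R x) A) \<omega>"
        by (simp add: rfn_def \<omega>_def)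
      from arg_cong [OF agree [OF this], where f = mor] show ?thesis
        using \<open>l > 0\<close> by simp
    qed
    have linear: "linear (o_seq T y)" for y
      using seq_bilinear by (simp add: bilinear_def)
    show "f = g"
    proof (rule arrow_ext_states)
      fix \<sigma> assume "arr \<sigma>" "src \<sigma> = \<I>" "tgt \<sigma> = src f"
      then have "mor \<sigma> \<in> span F"
        using F(3) by (auto simp: arr_def)
      then have "o_seq T (mor f) (mor \<sigma>) = o_seq T (mor g) (mor \<sigma>)"
        using linear_eq_on_span [of _ _ F, OF linear linear] basis by blast
      then show "f \<cdot> \<sigma> = g \<cdot> \<sigma>"
        by (intro arrow.expand) simp
    qed simp_all
  qed
qed

text \<open>Since \<open>C\<close> is a channel, a purification of its output on a faithful state
  has the same marginal on \<open>R\<close> as the faithful state itself. The reversible channel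
  linking the two purifications dilates \<open>C\<close> on the faithful state, and hence dilates
  \<open>C\<close>.\<close>

lemma ex_dilation:
  assumes "chan C" "chan \<rho>" "src \<rho> = \<I>" "tgt \<rho> = src C"
  obtains E U \<phi> where "rev U" "pstate \<phi>" "src U = src C \<odot> tgt \<phi>" "tgt U = tgt C \<odot> E"
    "(ident (tgt C) \<otimes> discard E) \<cdot> U \<cdot> (ident (src C) \<otimes> \<phi>) = C"
proof -
  define A B where "A = src C" "B = tgt C"
  have C [simp]: "chan C" "src C = A" "tgt C = B"
    using assms by (simp_all add: A_B_def)
  note [simp] = chan_arr
  obtain R \<tau> \<Psi> where \<Psi>: "purif R A \<tau> \<Psi>"
    and faithful: "\<And>f g. arr f \<Longrightarrow> arr g \<Longrightarrow> src f = A \<Longrightarrow> src g = A \<Longrightarrow> tgt f = tgt g \<Longrightarrow>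
      (ident R \<otimes> f) \<cdot> \<Psi> = (ident R \<otimes> g) \<cdot> \<Psi> \<Longrightarrow> f = g"
    using ex_faithful_state [OF assms(2-4)] C(2) by metis
  note [simp] = purifD [OF \<Psi>]
  obtain Y \<Theta> where \<Theta>: "purif (R \<odot> B) Y ((ident R \<otimes> C) \<cdot> \<Psi>) \<Theta>"
    using ex_purif [of "(ident R \<otimes> C) \<cdot> \<Psi>"] by auto
  note [simp] = purifD(1-5) [OF \<Theta>]
  have \<Theta>_marg: "(ident R \<otimes> ident B \<otimes> discard Y) \<cdot> \<Theta> = (ident R \<otimes> C) \<cdot> \<Psi>"
    using purifD(6) [OF \<Theta>] by simp
  have "(ident R \<otimes> discard B \<otimes> discard Y) \<cdot> \<Theta>
      = (ident R \<otimes> discard B) \<cdot> (ident R \<otimes> ident B \<otimes> discard Y) \<cdot> \<Theta>"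
    by simp
  also have "\<dots> = \<tau>"
    unfolding \<Theta>_marg by simp
  finally have "purif R (B \<odot> Y) \<tau> \<Theta>"
    by (simp add: purif_def)
  then obtain U \<phi> where U: "rev U" "src U = A \<odot> (B \<odot> Y) \<odot> R" "tgt U = (B \<odot> Y) \<odot> R \<odot> A"
    "pstate \<phi>" "tgt \<phi> = (B \<odot> Y) \<odot> R" "(ident R \<otimes> U) \<cdot> (\<Psi> \<otimes> \<phi>) = \<Theta> \<otimes> \<Psi>"
    by (rule purif_link [OF \<Psi>])
  note [simp] = U(1-5) rev_chan [OF U(1)] pstateD [OF U(4)]
  \<comment> \<open>The environment collects the purifying system \<open>Y\<close> together with the
    copy of \<open>\<Psi>\<close> left over by \<open>purif_link\<close>.\<close>
  let ?E = "Y \<odot> R \<odot> A"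
  let ?C' = "(ident B \<otimes> discard ?E) \<cdot> U \<cdot> (ident A \<otimes> \<phi>)"
  have "(ident R \<otimes> ?C') \<cdot> \<Psi> = (ident R \<otimes> ident B \<otimes> discard ?E) \<cdot>
      (ident R \<otimes> U) \<cdot> (ident R \<otimes> ident A \<otimes> \<phi>) \<cdot> \<Psi>"
    by simp
  also have "(ident R \<otimes> ident A \<otimes> \<phi>) \<cdot> \<Psi> = \<Psi> \<otimes> \<phi>"
    using tens_state_right [of \<Psi> \<phi>] by simp
  also have "(ident R \<otimes> ident B \<otimes> discard ?E) \<cdot> (ident R \<otimes> U) \<cdot> (\<Psi> \<otimes> \<phi>) = (ident R \<otimes> C) \<cdot> \<Psi>"
    unfolding U(6)
    using tens_comp [of \<Theta> "ident R \<otimes> ident B \<otimes> discard Y" \<Psi> "discard R \<otimes> discard A"]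
    by (simp add: \<Theta>_marg)
  finally have "?C' = C"
    by (rule faithful [rotated 5]) simp_all
  then show ?thesis
    using that [of U \<phi> ?E] by simp
qed

subsection \<open>Correctability and decoupling\<close>

text \<open>It condenses correctability into one equation. Effects on \<open>R\<close> commute with
  \<open>N\<close>; they turn \<open>\<Psi>\<close> into refinements of \<open>\<rho>\<close>, and
  by \<open>steering\<close> into all of them, while product effects separate states of
  \<open>A \<odot> R\<close>.\<close>

lemma fixes_refinements_iff:
  assumes \<Psi>: "purif A R \<rho> \<Psi>" and N: "arr N" "src N = A" "tgt N = A"
  shows "(\<forall>D. rfn D \<rho> \<longrightarrow> N \<cdot> D = D) \<longleftrightarrow> (N \<otimes> ident R) \<cdot> \<Psi> = \<Psi>"
proof
  note [simp] = purifD [OF \<Psi>] N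
  have slide: "N \<cdot> (ident A \<otimes> b) \<cdot> \<Psi> = (ident A \<otimes> b) \<cdot> (N \<otimes> ident R) \<cdot> \<Psi>"
    if [simp]: "arr b" "src b = R" "tgt b = \<I>" for b
    using tens_eq_comp_right [of N b] by simp
  show "(N \<otimes> ident R) \<cdot> \<Psi> = \<Psi>" if fixed: "\<forall>D. rfn D \<rho> \<longrightarrow> N \<cdot> D = D"
  proof (rule state_arrow_ext [of _ _ A R])
    fix a b assume [simp]: "arr a" "arr b" "src a = A" "src b = R" "tgt a = \<I>" "tgt b = \<I>"
    have "rfn ((ident A \<otimes> b) \<cdot> \<Psi>) \<rho>"
      using rfn_effect [OF rfn_self [of \<Psi>], of A R b] by simp
    then have eq: "(ident A \<otimes> b) \<cdot> (N \<otimes> ident R) \<cdot> \<Psi> = (ident A \<otimes> b) \<cdot> \<Psi>"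
      using fixed slide [of b] by (simp del: tens_comp_comp)
    have "(a \<otimes> b) \<cdot> x = a \<cdot> (ident A \<otimes> b) \<cdot> x" if [simp]: "arr x" "tgt x = A \<odot> R" for x
      using tens_eq_comp_right [of a b] by simp
    then show "(a \<otimes> b) \<cdot> (N \<otimes> ident R) \<cdot> \<Psi> = (a \<otimes> b) \<cdot> \<Psi>"
      using eq by (simp del: tens_comp_comp)
  qed simp_all
  show "\<forall>D. rfn D \<rho> \<longrightarrow> N \<cdot> D = D" if fixed: "(N \<otimes> ident R) \<cdot> \<Psi> = \<Psi>"
  proof (intro allI impI)
    fix D assume "rfn D \<rho>"
    then obtain b where b: "arr b" "src b = R" "tgt b = \<I>" "D = (ident A \<otimes> b) \<cdot> \<Psi>"
      by (rule steering [OF \<Psi>])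
    then show "N \<cdot> D = D"
      using slide [of b] by (simp add: fixed del: tens_comp_comp)
  qed
qed

text \<open>Discarding the environment of the dilation leaves \<open>C\<close>, to which the
  recovery \<open>N\<close> is then applied.\<close>

lemma recovery_discard:
  assumes "arr N" "src N = B" "arr V" "tgt V = B \<odot> E" "(ident B \<otimes> discard E) \<cdot> V = C"
    and "arr \<Psi>" "tgt \<Psi> = src V \<odot> R"
  shows "(N \<otimes> discard E \<otimes> ident R) \<cdot> (V \<otimes> ident R) \<cdot> \<Psi> = ((N \<cdot> C) \<otimes> ident R) \<cdot> \<Psi>"
proof -
  have "((N \<otimes> discard E) \<otimes> ident R) \<cdot> (V \<otimes> ident R) \<cdot> \<Psi> = (((N \<otimes> discard E) \<cdot> V) \<otimes> ident R) \<cdot> \<Psi>"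
    using assms by (simp del: tens_assoc)
  moreover have "(N \<otimes> discard E) \<cdot> V = N \<cdot> C"
    using assms tens_eq_comp_right [of N "discard E"] by (simp flip: assms(5))
  ultimately show ?thesis
    using assms by simp
qed

text \<open>If a recovery exists, the recovered state has the pure marginal \<open>\<Psi>\<close>, so the environment
  factors out.\<close>

lemma correctable_imp_decoupled:
  assumes \<Psi>: "purif A R \<rho> \<Psi>" and V: "chan V" "src V = A" "tgt V = B \<odot> E"
    and C: "(ident B \<otimes> discard E) \<cdot> V = C" and N: "chan N" "src N = B" "tgt N = A"
    and fixed: "((N \<cdot> C) \<otimes> ident R) \<cdot> \<Psi> = \<Psi>"
  obtains \<sigma> where "chan \<sigma>" "src \<sigma> = \<I>" "tgt \<sigma> = E"
    "(discard B \<otimes> ident E \<otimes> ident R) \<cdot> (V \<otimes> ident R) \<cdot> \<Psi> = \<sigma> \<otimes> ((discard A \<otimes> ident R) \<cdot> \<Psi>)"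
proof -
  note [simp] = purifD [OF \<Psi>] V N chan_arr
  \<comment> \<open>The environment is moved to the end, so that the recovered systems
    \<open>A\<close> and \<open>R\<close> are adjacent and \<open>rfn_pure_marginal\<close> applies
    to the split \<open>A \<odot> R\<close> against \<open>E\<close>.\<close>
  define Z where "Z = (ident A \<otimes> swp E R) \<cdot> (N \<otimes> ident E \<otimes> ident R) \<cdot> (V \<otimes> ident R) \<cdot> \<Psi>"
  define X where "X = (V \<otimes> ident R) \<cdot> \<Psi>"
  have [simp]: "chan X" "src X = \<I>" "tgt X = B \<odot> E \<odot> R"
    by (simp_all add: X_def)
  have Z_X: "Z = (ident A \<otimes> swp E R) \<cdot> (N \<otimes> ident E \<otimes> ident R) \<cdot> X"
    by (simp only: X_def Z_def)
  have [simp]: "chan Z" "src Z = \<I>" "tgt Z = A \<odot> R \<odot> E"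
    by (simp_all add: Z_X)
  have "(ident A \<otimes> ident R \<otimes> discard E) \<cdot> Z = (N \<otimes> discard E \<otimes> ident R) \<cdot> X"
    by (simp add: Z_X)
  also have "\<dots> = \<Psi>"
    unfolding X_def by (subst recovery_discard [OF _ _ _ _ C]) (simp_all add: fixed)
  finally have marg: "(ident (A \<odot> R) \<otimes> discard E) \<cdot> Z = \<Psi>"
    by simp
  define \<sigma> where "\<sigma> = (discard (A \<odot> R) \<otimes> ident E) \<cdot> Z"
  have [simp]: "chan \<sigma>" "src \<sigma> = \<I>" "tgt \<sigma> = E"
    by (simp_all add: \<sigma>_def)
  have Z: "Z = \<Psi> \<otimes> \<sigma>"
    unfolding \<sigma>_def by (rule rfn_pure_marginal [OF rfn_self _ marg]) simp_all
  \<comment> \<open>As \<open>N\<close> is a channel, discarding \<open>B\<close> is the same as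
    applying \<open>N\<close> and discarding \<open>A\<close>.\<close>
  have "(discard B \<otimes> ident E \<otimes> ident R) \<cdot> X = (discard A \<otimes> swp R E) \<cdot> Z"
    by (simp add: Z_X)
  also have "\<dots> = swp R E \<cdot> (discard A \<otimes> ident R \<otimes> ident E) \<cdot> Z"
    using tens_eq_comp_left [of "swp R E" "discard A"] by (simp flip: comp_assoc)
  also have "(discard A \<otimes> ident R \<otimes> ident E) \<cdot> Z = ((discard A \<otimes> ident R) \<cdot> \<Psi>) \<otimes> \<sigma>"
    unfolding Z by (subst tens3_comp) simp_all
  also have "swp R E \<cdot> \<dots> = \<sigma> \<otimes> ((discard A \<otimes> ident R) \<cdot> \<Psi>)"
    using swp_state [of "(discard A \<otimes> ident R) \<cdot> \<Psi>" \<sigma>] by simp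
  finally show ?thesis
    using that [of \<sigma>] by (simp add: X_def)
qed

text \<open>Conversely, \<open>V\<close> applied to \<open>\<Psi>\<close> and \<open>\<Psi>\<close> itself, tensored with a purification of \<open>\<sigma>\<close>, purify the
  same state of \<open>ER\<close>, and the channel connecting their purifying systems is the recovery.\<close>

lemma decoupled_imp_correctable:
  assumes \<Psi>: "purif A R \<rho> \<Psi>" and U: "rev U" "src U = A \<odot> tgt \<phi>" "tgt U = B \<odot> E" and \<phi>: "pstate \<phi>"
    and V: "V = U \<cdot> (ident A \<otimes> \<phi>)" and C: "(ident B \<otimes> discard E) \<cdot> V = C"
    and \<sigma>: "chan \<sigma>" "src \<sigma> = \<I>" "tgt \<sigma> = E"
    and dec: "(discard B \<otimes> ident E \<otimes> ident R) \<cdot> (V \<otimes> ident R) \<cdot> \<Psi> = \<sigma> \<otimes> ((discard A \<otimes> ident R) \<cdot> \<Psi>)"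
  obtains N where "chan N" "src N = B" "tgt N = A" "((N \<cdot> C) \<otimes> ident R) \<cdot> \<Psi> = \<Psi>"
proof -
  note [simp] = purifD [OF \<Psi>] U pstateD [OF \<phi>] rev_chan [OF U(1)] \<sigma> chan_arr \<phi>
  have [simp]: "chan V" "src V = A" "tgt V = B \<odot> E"
    by (simp_all add: V)
  define \<Xi> where "\<Xi> = (V \<otimes> ident R) \<cdot> \<Psi>"
  \<comment> \<open>The ancilla state is moved next to \<open>A\<close>. This exhibits
    \<open>\<Xi>\<close> as the image of the pure state \<open>\<Psi> \<otimes> \<phi>\<close> under
    reversible channels, hence as pure.\<close>
  have "(ident A \<otimes> swp R (tgt \<phi>)) \<cdot> (\<Psi> \<otimes> \<phi>) = (ident A \<otimes> swp R (tgt \<phi>)) \<cdot> (ident A \<otimes> ident R \<otimes> \<phi>) \<cdot> \<Psi>"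
    using tens_state_right [of \<Psi> \<phi>] by simp
  also have "\<dots> = (ident A \<otimes> \<phi> \<otimes> ident R) \<cdot> \<Psi>"
    using swp_natural [of "ident R" \<phi> R "tgt \<phi>"] by simp
  finally have "(U \<otimes> ident R) \<cdot> (ident A \<otimes> swp R (tgt \<phi>)) \<cdot> (\<Psi> \<otimes> \<phi>)
      = (U \<otimes> ident R) \<cdot> ((ident A \<otimes> \<phi>) \<otimes> ident R) \<cdot> \<Psi>"
    by simp
  also have "\<dots> = \<Xi>"
    by (simp add: \<Xi>_def V del: tens_assoc)
  finally have \<Xi>_eq: "\<Xi> = (U \<otimes> ident R) \<cdot> (ident A \<otimes> swp R (tgt \<phi>)) \<cdot> (\<Psi> \<otimes> \<phi>)" ..
  have \<Xi> [simp]: "pstate \<Xi>" "tgt \<Xi> = B \<odot> E \<odot> R"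
    unfolding \<Xi>_eq by (auto intro!: pstate_rev pstate_tens rev_tens)
  note [simp] = pstateD [OF \<Xi>(1)]
  define \<rho>' where "\<rho>' = (discard A \<otimes> ident R) \<cdot> \<Psi>"
  \<comment> \<open>Decoupling enters here: it identifies the marginal of \<open>\<Xi>\<close> on
    \<open>E \<odot> R\<close>, with \<open>B\<close> as purifying system, as a product.\<close>
  have 1: "purif (E \<odot> R) B (\<sigma> \<otimes> \<rho>') (swp B (E \<odot> R) \<cdot> \<Xi>)"
    using purif_swap [of \<Xi> B "E \<odot> R"] dec by (simp add: \<rho>'_def flip: \<Xi>_def)
  obtain F \<Phi> where \<Phi>: "purif E F \<sigma> \<Phi>"
    using ex_purif [of \<sigma>] by auto
  note [simp] = purifD [OF \<Phi>]
  \<comment> \<open>The factors of \<open>\<Phi> \<otimes> \<Psi>\<close> are rearranged so that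
    \<open>E \<odot> R\<close> comes first and \<open>F \<odot> A\<close> is the purifying
    system.\<close>
  define \<Lambda> where "\<Lambda> = (ident E \<otimes> swp (F \<odot> A) R) \<cdot> (\<Phi> \<otimes> \<Psi>)"
  have [simp]: "pstate \<Lambda>" "tgt \<Lambda> = E \<odot> R \<odot> F \<odot> A"
    unfolding \<Lambda>_def by (auto intro!: pstate_rev pstate_tens rev_tens)
  have "(ident R \<otimes> discard F \<otimes> discard A) \<cdot> swp (F \<odot> A) R = discard F \<otimes> discard A \<otimes> ident R"
    using discard_swp(1) [of R "F \<odot> A"] by simp
  then have "(ident E \<otimes> ident R \<otimes> discard F \<otimes> discard A) \<cdot> \<Lambda> = \<sigma> \<otimes> \<rho>'"
    by (simp add: \<Lambda>_def \<rho>'_def tens3_comp)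
  then have "purif (E \<odot> R) (F \<odot> A) (\<sigma> \<otimes> \<rho>') \<Lambda>"
    by (simp add: purif_def)
  then obtain K where [simp]: "chan K" "src K = B" "tgt K = F \<odot> A"
    and K: "(ident (E \<odot> R) \<otimes> K) \<cdot> swp B (E \<odot> R) \<cdot> \<Xi> = \<Lambda>"
    by (rule purif_channel [OF 1])
  \<comment> \<open>\<open>K\<close> produces \<open>F\<close> together with \<open>A\<close>;
    discarding the purifying system \<open>F\<close> of \<open>\<sigma>\<close> leaves the recovered
    input.\<close>
  define N where "N = (discard F \<otimes> ident A) \<cdot> K"
  have [simp]: "chan N" "src N = B" "tgt N = A"
    by (simp_all add: N_def)
  have nat: "(ident R \<otimes> discard F \<otimes> ident A) \<cdot> swp (F \<odot> A) R = swp A R \<cdot> (discard F \<otimes> ident A \<otimes> ident R)"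
    using swp_natural [of "discard F \<otimes> ident A" "ident R" A R] by simp
  have "(discard E \<otimes> ident R \<otimes> discard F \<otimes> ident A) \<cdot> \<Lambda>
      = (discard E \<otimes> (swp A R \<cdot> (discard F \<otimes> ident A \<otimes> ident R))) \<cdot> (\<Phi> \<otimes> \<Psi>)"
    by (simp add: \<Lambda>_def nat)
  also have "\<dots> = swp A R \<cdot> (discard E \<otimes> discard F \<otimes> ident A \<otimes> ident R) \<cdot> (\<Phi> \<otimes> \<Psi>)"
    using tens_comp [of "discard E" "ident \<I>" "discard F \<otimes> ident A \<otimes> ident R" "swp A R"]
    by (simp flip: comp_assoc)
  also have "\<dots> = swp A R \<cdot> \<Psi>"
    by (simp add: tens3_comp)
  finally have L: "(discard E \<otimes> ident R \<otimes> discard F \<otimes> ident A) \<cdot> \<Lambda> = swp A R \<cdot> \<Psi>" .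
  have "(discard E \<otimes> ident R \<otimes> discard F \<otimes> ident A) \<cdot> \<Lambda> = (discard E \<otimes> ident R \<otimes> N) \<cdot> swp B (E \<odot> R) \<cdot> \<Xi>"
    unfolding K [symmetric] by (simp add: N_def)
  also have "\<dots> = swp A R \<cdot> (N \<otimes> discard E \<otimes> ident R) \<cdot> \<Xi>"
    using swp_natural [of N "discard E \<otimes> ident R" A R] by (simp flip: comp_assoc)
  also have "(N \<otimes> discard E \<otimes> ident R) \<cdot> \<Xi> = ((N \<cdot> C) \<otimes> ident R) \<cdot> \<Psi>"
    unfolding \<Xi>_def by (rule recovery_discard [OF _ _ _ _ C]) simp_all
  finally have eq: "swp A R \<cdot> ((N \<cdot> C) \<otimes> ident R) \<cdot> \<Psi> = swp A R \<cdot> \<Psi>"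
    unfolding L ..
  have [simp]: "chan C" "src C = A" "tgt C = B"
    unfolding C [symmetric] by simp_all
  \<comment> \<open>The swap on both sides is cancelled by its inverse.\<close>
  from arg_cong [OF eq, of "\<lambda>x. swp R A \<cdot> x"] have "((N \<cdot> C) \<otimes> ident R) \<cdot> \<Psi> = \<Psi>"
    by simp
  then show ?thesis
    using that [of N] by simp
qed

end

theorem mainTheorem16:
  fixes T :: "('s, 't::real_normed_vector) opt"
    and A B :: 's and \<rho> C :: 't
  assumes "OPT_framework T"
    and "purification_postulate T"
    and "\<rho> \<in> norm_states T A"
    and "channel T A B C"
  shows "correctable T A B C \<rho> \<longleftrightarrow>
    (\<exists>E V R \<Psi> \<sigma>. rev_dilation T A B E C V \<and> purification T A R \<rho> \<Psi> \<and>
       \<sigma> \<in> norm_states T E \<and>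
       o_seq T (o_ten T (o_ten T (det_eff T B) (o_id T E)) (o_id T R))
               (o_seq T (o_ten T V (o_id T R)) \<Psi>)
         = o_ten T \<sigma> (o_seq T (o_ten T (det_eff T A) (o_id T R)) \<Psi>))"
    (is "_ \<longleftrightarrow> ?rhs")
proof -
  interpret purification_theory T
    by unfold_locales (use assms in auto)
  define r c where "r = Arrow \<I> \<rho> A" "c = Arrow A C B"
  have r [simp]: "chan r" "src r = \<I>" "tgt r = A" and c [simp]: "chan c" "src c = A" "tgt c = B"
    using assms(3,4) by (simp_all add: r_c_def chan_def norm_states_iff_channel)
  note [simp] = chan_arr
  have rfn_iff: "rfn D r \<longleftrightarrow> (\<exists>d\<in>refinement_set T \<I> A \<rho>. D = Arrow \<I> d A)" for D
    by (cases D) (auto simp: rfn_def refinement_set_def r_c_def)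
  show ?thesis
  proof
    assume "correctable T A B C \<rho>"
    then obtain n where n: "channel T B A n"
      "\<And>d. d \<in> refinement_set T \<I> A \<rho> \<Longrightarrow> o_seq T n (o_seq T C d) = d"
      unfolding correctable_def by blast
    define N where "N = Arrow B n A"
    have [simp]: "chan N" "src N = B" "tgt N = A"
      using n by (simp_all add: N_def chan_def)
    have "(N \<cdot> c) \<cdot> D = D" if "rfn D r" for D
    proof -
      obtain d where "d \<in> refinement_set T \<I> A \<rho>" "D = Arrow \<I> d A"
        using \<open>rfn D r\<close> by (auto simp: rfn_iff)
      then have "N \<cdot> c \<cdot> D = D"
        using n(2) by (simp add: N_def r_c_def comp_def)
      then show ?thesis
        using rfnD [OF that] by simp
    qed
    moreover obtain R \<Psi> where \<Psi>: "purif A R r \<Psi>"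
      using ex_purif [of r] by auto
    ultimately have fixed: "((N \<cdot> c) \<otimes> ident R) \<cdot> \<Psi> = \<Psi>"
      using fixes_refinements_iff [OF \<Psi>, of "N \<cdot> c"] by simp
    obtain E U \<phi> where U: "rev U" "pstate \<phi>" "src U = A \<odot> tgt \<phi>" "tgt U = B \<odot> E"
      and dil: "(ident B \<otimes> discard E) \<cdot> U \<cdot> (ident A \<otimes> \<phi>) = c"
      by (rule ex_dilation [OF c(1) r(1,2), unfolded r c, OF refl])
    define V where "V = U \<cdot> (ident A \<otimes> \<phi>)"
    have V: "chan V" "src V = A" "tgt V = B \<odot> E"
      using U pstateD [OF U(2)] rev_chan [OF U(1)] by (simp_all add: V_def)
    obtain \<sigma> where \<sigma>: "chan \<sigma>" "src \<sigma> = \<I>" "tgt \<sigma> = E" and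
      dec: "(discard B \<otimes> ident E \<otimes> ident R) \<cdot> (V \<otimes> ident R) \<cdot> \<Psi> = \<sigma> \<otimes> ((discard A \<otimes> ident R) \<cdot> \<Psi>)"
      using correctable_imp_decoupled [OF \<Psi> V dil [folded V_def] _ _ _ fixed] by auto
    have "rev_dilation T A B E C (mor V)"
      unfolding rev_dilation_def
    proof (intro conjI exI)
      show "channel T A (B \<odot> E) (mor V)"
        using V by (auto simp: chan_def)
      show "o_seq T (o_ten T (o_id T B) (det_eff T E)) (mor V) = C"
        using arg_cong [OF dil, of mor] by (simp add: V_def r_c_def)
      show "pure_state T (tgt \<phi>) (mor \<phi>)"
        using U(2) by (auto simp: pstate_def pure_state_def states_def chan_def channel_def)
      show "reversible T (A \<odot> tgt \<phi>) (B \<odot> E) (mor U)"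
        using U by (simp add: reversible_iff) (metis arrow.collapse)
      show "mor V = o_seq T (mor U) (o_ten T (o_id T A) (mor \<phi>))"
        by (simp add: V_def)
    qed
    moreover have "purification T A R \<rho> (mor \<Psi>)"
      using \<Psi> purifD [OF \<Psi>] by (simp add: purification_iff r_c_def) (metis arrow.collapse)
    moreover have "mor \<sigma> \<in> norm_states T E"
      using \<sigma> by (auto simp: norm_states_iff_channel chan_def)
    \<comment> \<open>The claim brackets the tensor to the left, whereas \<open>dec\<close> has it
      nested to the right.\<close>
    moreover have "(discard B \<otimes> ident E) \<otimes> ident R = discard B \<otimes> ident E \<otimes> ident R"
      by simp
    then have "mor (((discard B \<otimes> ident E) \<otimes> ident R) \<cdot> (V \<otimes> ident R) \<cdot> \<Psi>)
        = mor (\<sigma> \<otimes> ((discard A \<otimes> ident R) \<cdot> \<Psi>))"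
      using dec by (simp only:)
    note this [unfolded arrow_projections]
    ultimately show ?rhs
      by blast
  next
    assume ?rhs
    then obtain E v R \<psi> s where dil: "rev_dilation T A B E C v" and \<psi>: "purification T A R \<rho> \<psi>"
      and s: "s \<in> norm_states T E"
      and dec: "o_seq T (o_ten T (o_ten T (det_eff T B) (o_id T E)) (o_id T R))
               (o_seq T (o_ten T v (o_id T R)) \<psi>)
         = o_ten T s (o_seq T (o_ten T (det_eff T A) (o_id T R)) \<psi>)"
      by blast
    obtain E0 f u where f: "pure_state T E0 f" and u: "reversible T (A \<odot> E0) (B \<odot> E) u"
      and v: "v = o_seq T u (o_ten T (o_id T A) f)" "channel T A (B \<odot> E) v"
      "o_seq T (o_ten T (o_id T B) (det_eff T E)) v = C"
      using dil unfolding rev_dilation_def by blast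
    define \<Psi> \<sigma> \<phi> U V where "\<Psi> = Arrow \<I> \<psi> (A \<odot> R)" "\<sigma> = Arrow \<I> s E" "\<phi> = Arrow \<I> f E0"
      "U = Arrow (A \<odot> E0) u (B \<odot> E)" "V = Arrow A v (B \<odot> E)"
    note defs = \<Psi>_\<sigma>_\<phi>_U_V_def
    have \<Psi>: "purif A R r \<Psi>"
      using \<psi> by (simp add: purification_iff defs r_c_def)
    have \<sigma>: "chan \<sigma>" "src \<sigma> = \<I>" "tgt \<sigma> = E"
      using s by (simp_all add: defs norm_states_iff_channel chan_def)
    have U: "rev U" "src U = A \<odot> E0" "tgt U = B \<odot> E"
      using u by (simp_all add: defs reversible_iff)
    have \<phi>: "arr \<phi>" "src \<phi> = \<I>" "tgt \<phi> = E0"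
      using f by (simp_all add: defs arr_def pure_state_def states_def)
    have V: "V = U \<cdot> (ident A \<otimes> \<phi>)" "chan V" "src V = A" "tgt V = B \<odot> E"
      using v(1,2) by (auto simp: defs chan_def intro: arrow.expand)
    note [simp] = U \<phi> rev_chan [OF U(1)]
    \<comment> \<open>A reversible dilation only asks for a pure ancilla state, while
      \<open>pstate\<close> also demands normalization. Since \<open>V\<close> and \<open>U\<close>
      are channels, discarding all outputs shows that the total probability of \<open>\<phi>\<close>
      acts as a trivial factor.\<close>
    have "discard A = discard A \<otimes> (discard E0 \<cdot> \<phi>)"
    proof -
      have "discard A = (discard B \<otimes> discard E) \<cdot> V"
        using V by simp
      also have "\<dots> = ((discard B \<otimes> discard E) \<cdot> U) \<cdot> (ident A \<otimes> \<phi>)"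
        unfolding V(1) by (simp del: discard_tens_comp)
      also have "(discard B \<otimes> discard E) \<cdot> U = discard A \<otimes> discard E0"
        by simp
      finally show ?thesis
        by simp
    qed
    \<comment> \<open>Evaluating on the normalized state \<open>r\<close> cancels the factor
      \<open>discard A\<close>.\<close>
    then have "discard A \<cdot> r = (discard A \<otimes> (discard E0 \<cdot> \<phi>)) \<cdot> (r \<otimes> ident \<I>)"
      by simp
    then have "ident \<I> = discard E0 \<cdot> \<phi>"
      by (simp del: tens_unit(1))
    then have "channel T \<I> E0 f"
      using f by (simp add: channel_def det_eff_unit pure_state_def states_def comp_def ident_def defs)
    then have "pstate \<phi>"
      using f by (simp add: pstate_def pure_state_def chan_def defs)
    moreover have "(ident B \<otimes> discard E) \<cdot> V = c"
      using v(3) by (intro arrow.expand) (simp add: defs r_c_def)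
    moreover have "((discard B \<otimes> ident E) \<otimes> ident R) \<cdot> (V \<otimes> ident R) \<cdot> \<Psi> = \<sigma> \<otimes> ((discard A \<otimes> ident R) \<cdot> \<Psi>)"
      using dec by (intro arrow.expand) (simp add: defs del: tens_assoc)
    then have "(discard B \<otimes> ident E \<otimes> ident R) \<cdot> (V \<otimes> ident R) \<cdot> \<Psi> = \<sigma> \<otimes> ((discard A \<otimes> ident R) \<cdot> \<Psi>)"
      by simp
    ultimately obtain N where N: "chan N" "src N = B" "tgt N = A" "((N \<cdot> c) \<otimes> ident R) \<cdot> \<Psi> = \<Psi>"
      using decoupled_imp_correctable [OF \<Psi>, of U \<phi> B E V c \<sigma>] V(1) \<sigma> by auto
    then have fixed: "(N \<cdot> c) \<cdot> D = D" if "rfn D r" for D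
      using fixes_refinements_iff [OF \<Psi>, of "N \<cdot> c"] that by simp
    show "correctable T A B C \<rho>"
      unfolding correctable_def
    proof (intro exI conjI ballI)
      show "channel T B A (mor N)"
        using N by (auto simp: chan_def)
      fix d assume "d \<in> refinement_set T \<I> A \<rho>"
      then have D: "rfn (Arrow \<I> d A) r"
        by (auto simp: rfn_iff)
      then have "N \<cdot> c \<cdot> Arrow \<I> d A = Arrow \<I> d A"
        using fixed [OF D] rfnD [OF D] N by simp
      then show "o_seq T (mor N) (o_seq T C d) = d"
        by (simp add: comp_def r_c_def)
    qed
  qed
qed

end
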